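(* Let $a>1$, $p\ge 2$, $B<1$ and $A\ge 1+\frac{p}{2}(1-B)$. Then there exists a positive constant $C_{p,A,B}$ such that the inequality $$C_{p,A,B}\left(\int_{\Omega}\frac{|u|^p}{|x|^2\left(\log\frac{a}{|x|}\right)^A}\,dx\right)^{\frac{2}{p}}\le\int_{\Omega}\left(\log\frac{a}{|x|}\right)^{B}|\nabla u|^2\,dx$$ holds for every $u\in C_c^\infty(\Omega)$.
   Context: $\Omega\subset\mathbb{R}^2$ is a smooth bounded domain with $0\in\overline{\Omega}$ and $\sup_{x\in\Omega}|x|=1$. The parameters $a,p,A,B$ and the domain $\Omega$ are fixed before the constant is chosen. *)

theory Defs
  imports "HOL-Analysis.Analysis"
begin

text \<open>On an open set \<open>S\<close>, membership in \<open>C\<^sup>k\<close>: differentiable \<open>k\<close> times, in all directions, with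
  continuous derivatives.\<close>

primrec Ck_on :: "nat \<Rightarrow> 'a::real_normed_vector set \<Rightarrow> ('a \<Rightarrow> 'b::real_normed_vector) \<Rightarrow> bool" where
  "Ck_on 0 S f \<longleftrightarrow> continuous_on S f"
| "Ck_on (Suc k) S f \<longleftrightarrow>
     (\<forall>x\<in>S. f differentiable (at x)) \<and> (\<forall>v. Ck_on k S (\<lambda>x. frechet_derivative f (at x) v))"

definition smooth_on :: "'a::real_normed_vector set \<Rightarrow> ('a \<Rightarrow> 'b::real_normed_vector) \<Rightarrow> bool" where
  "smooth_on S f \<longleftrightarrow> (\<forall>k. Ck_on k S f)"

text \<open>\<open>C_c\<^sup>\<infinity>(\<Omega>)\<close>; its elements are represented by their extensions by zero to the whole space.\<close>

definition test_functions :: "'a::real_normed_vector set \<Rightarrow> ('a \<Rightarrow> real) set" where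
  "test_functions \<Omega> =
     {u. smooth_on UNIV u \<and> compact (closure {x. u x \<noteq> 0}) \<and> closure {x. u x \<noteq> 0} \<subseteq> \<Omega>}"

definition gradient :: "(real^'n \<Rightarrow> real) \<Rightarrow> real^'n \<Rightarrow> real^'n" where
  "gradient u x = (\<chi> i. frechet_derivative u (at x) (axis i 1))"

text \<open>A planar set has smooth boundary if near every boundary point, in suitable Cartesian
  coordinates (given by an orthonormal frame \<open>e, \<nu>\<close>), it is the region strictly above the graph of
  a smooth function.\<close>

definition smooth_boundary :: "(real^2) set \<Rightarrow> bool" where
  "smooth_boundary \<Omega> \<longleftrightarrow>
     (\<forall>z\<in>frontier \<Omega>. \<exists>r>0. \<exists>e \<nu>. \<exists>\<gamma>::real \<Rightarrow> real.
        norm e = 1 \<and> norm \<nu> = 1 \<and> e \<bullet> \<nu> = 0 \<and> smooth_on UNIV \<gamma> \<and>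
        \<Omega> \<inter> ball z r = {x \<in> ball z r. x \<bullet> \<nu> > \<gamma> (x \<bullet> e)})"

definition smooth_bounded_domain :: "(real^2) set \<Rightarrow> bool" where
  "smooth_bounded_domain \<Omega> \<longleftrightarrow>
     open \<Omega> \<and> connected \<Omega> \<and> \<Omega> \<noteq> {} \<and> bounded \<Omega> \<and> smooth_boundary \<Omega>"

end

theory Submission
  imports Defs
begin

text \<open>
  With \<open>s = ln (a / |x|)\<close> and the angle \<open>t\<close> as coordinates, the inequality becomes, for \<open>\<beta> = 1 - B\<close>
  and up to a power of \<open>l = ln a\<close> that accounts for a larger \<open>A\<close>,
  a bound of \<open>\<integral>\<integral> |U|^p s^(- 1 - p \<beta> / 2)\<close> by the power \<open>p / 2\<close> of
  \<open>\<integral>\<integral> s^(1 - \<beta>) (U_s^2 + U_t^2)\<close> on the half cylinder \<open>s > l\<close>, for functions that vanish at \<open>s = l\<close>.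
  By homogeneity the right-hand side may be taken to be at most 1.
  The case \<open>p = 2\<close> is Hardy's inequality on each ray. The even exponents follow by induction:
  \<open>|U|^m\<close> is bounded by the integral of \<open>m |U|^(m - 1) |U_s|\<close> along the ray and, up to its mean, by that of
  \<open>m |U|^(m - 1) |U_t|\<close> along the circle; multiplying the two bounds as in the Gagliardo-Nirenberg
  argument controls the moment of order \<open>2 m\<close> by the one of order \<open>2 m - 2\<close> and the energy. All other
  exponents lie between two even ones.
\<close>

subsection \<open>One-dimensional inequalities\<close>

text \<open>The extended nonnegative integral on the right can later be enlarged to a whole ray or
  circle without any check of integrability.\<close>

lemma abs_diff_le_nn_integral_derivative:
  fixes f f' :: "real \<Rightarrow> real"
  assumes deriv: "\<And>x. x \<in> {a..b} \<Longrightarrow> (f has_real_derivative f' x) (at x)"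
    and cont: "continuous_on {a..b} f'" and "a \<le> b"
  shows "ennreal \<bar>f b - f a\<bar> \<le> (\<integral>\<^sup>+x\<in>{a..b}. ennreal \<bar>f' x\<bar> \<partial>lborel)"
proof -
  have int: "(f' has_integral (f b - f a)) {a..b}"
    using assms by (intro fundamental_theorem_of_calculus)
      (auto simp: has_real_derivative_iff_has_vector_derivative intro: has_vector_derivative_at_within)
  have abs: "(\<lambda>x. \<bar>f' x\<bar>) integrable_on {a..b}"
    by (intro integrable_continuous_real continuous_intros cont)
  have "\<bar>f b - f a\<bar> \<le> integral {a..b} (\<lambda>x. \<bar>f' x\<bar>)"
    using integral_norm_bound_integral[OF has_integral_integrable[OF int] abs] int
    by (auto simp: integral_unique)
  moreover have "(\<integral>\<^sup>+x\<in>{a..b}. ennreal \<bar>f' x\<bar> \<partial>lborel) = ennreal (integral {a..b} (\<lambda>x. \<bar>f' x\<bar>))"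
    by (rule nn_integral_has_integral_lebesgue') (use abs in auto)
  ultimately show ?thesis by (simp add: ennreal_leI)
qed

text \<open>Integrate the derivative \<open>?F'\<close> of \<open>?F\<close>. It consists of the
  left-hand integrand and a cross term in \<open>f * f'\<close>; completing a square bounds the
  cross term by half of the left-hand integrand plus a multiple of the right-hand one.\<close>

lemma hardy_inequality_interval:
  fixes f f' :: "real \<Rightarrow> real"
  assumes deriv: "\<And>x. x \<in> {l..T} \<Longrightarrow> (f has_real_derivative f' x) (at x)"
    and cont: "continuous_on {l..T} f'" and l: "0 < l" "l \<le> T" and "f l = 0" and \<beta>: "\<beta> > 0"
  shows "(\<integral>\<^sup>+x\<in>{l..T}. ennreal ((f x)\<^sup>2 * x powr (- \<beta>) / x) \<partial>lborel)
    \<le> ennreal (4 / \<beta>\<^sup>2) * (\<integral>\<^sup>+x\<in>{l..T}. ennreal (x powr (1 - \<beta>) * (f' x)\<^sup>2) \<partial>lborel)"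
proof -
  let ?P = "\<lambda>x. (f x)\<^sup>2 * x powr (- \<beta>) / x" and ?Q = "\<lambda>x. x powr (1 - \<beta>) * (f' x)\<^sup>2"
  let ?F = "\<lambda>x. - (f x)\<^sup>2 * x powr (- \<beta>) / \<beta>"
  let ?F' = "\<lambda>x. ?P x - 2 / \<beta> * (f x * f' x * x powr (- \<beta>))"
  have contf: "continuous_on {l..T} f"
    by (rule continuous_at_imp_continuous_on) (blast intro: DERIV_isCont deriv)
  have F: "(?F' has_integral (?F T - ?F l)) {l..T}"
  proof (rule fundamental_theorem_of_calculus)
    fix x assume x: "x \<in> {l..T}"
    then have "x > 0" using l by auto
    have p: "((\<lambda>x. x powr (- \<beta>)) has_real_derivative - \<beta> * (x powr (- \<beta>) / x)) (at x)"
      using DERIV_powr[OF DERIV_ident \<open>x > 0\<close> DERIV_const[of "- \<beta>"]] \<open>x > 0\<close> by (simp add: mult.commute)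
    have "(?F has_real_derivative - (2 * f x * f' x * x powr (- \<beta>)
        + (f x)\<^sup>2 * (- \<beta> * (x powr (- \<beta>) / x))) / \<beta>) (at x)"
      using DERIV_cdivide[OF DERIV_mult[OF DERIV_minus[OF DERIV_power[OF deriv[OF x], where n = 2]] p], where c = \<beta>]
      by (rule DERIV_cong) simp
    also have "- (2 * f x * f' x * x powr (- \<beta>) + (f x)\<^sup>2 * (- \<beta> * (x powr (- \<beta>) / x))) / \<beta> = ?F' x"
      using \<beta> \<open>x > 0\<close> by (simp add: field_simps)
    finally have "(?F has_real_derivative ?F' x) (at x)" .
    then show "(?F has_vector_derivative ?F' x) (at x within {l..T})"
      by (auto simp: has_real_derivative_iff_has_vector_derivative intro: has_vector_derivative_at_within)
  qed fact
  have iP: "?P integrable_on {l..T}" and iQ: "?Q integrable_on {l..T}"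
    using l by (auto intro!: integrable_continuous_real continuous_intros contf cont)
  have "integral {l..T} (\<lambda>x. ?P x / 2 - 2 / \<beta>\<^sup>2 * ?Q x) \<le> integral {l..T} ?F'"
  proof (rule integral_le)
    show "(\<lambda>x. ?P x / 2 - 2 / \<beta>\<^sup>2 * ?Q x) integrable_on {l..T}"
      by (rule integrable_diff[OF integrable_on_divide[OF iP] integrable_on_mult_right[OF iQ]])
    show "?F' integrable_on {l..T}" using F by blast
    fix x assume x: "x \<in> {l..T}"
    then have "x > 0" using l by auto
    \<comment> \<open>In terms of the square roots \<open>y\<close> of
      \<open>x powr (- \<beta>)\<close> and \<open>z\<close> of \<open>x\<close>, the completed
      square is a rational identity. The coefficient \<open>2 / \<beta>\<close> makes its mixed term
      equal to the cross term of \<open>?F'\<close>.\<close>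
    define y where "y = x powr (- \<beta> / 2)"
    have y: "x powr (- \<beta>) = y\<^sup>2" "x powr (1 - \<beta>) = x * y\<^sup>2"
      using \<open>x > 0\<close> by (simp_all add: y_def powr_power powr_diff powr_minus field_simps)
    define z where "z = sqrt x"
    have z: "z \<noteq> 0" "x = z\<^sup>2" using \<open>x > 0\<close> by (auto simp: z_def)
    have alg: "(F / z - 2 / \<beta> * G * z)\<^sup>2 * y\<^sup>2 / 2
        = F\<^sup>2 * y\<^sup>2 / z\<^sup>2 / 2 + 2 / \<beta>\<^sup>2 * (z\<^sup>2 * y\<^sup>2 * G\<^sup>2) - 2 / \<beta> * (F * G * y\<^sup>2)" for F G
      using z(1) \<beta> by (simp add: power2_eq_square field_simps)
    have "0 \<le> (f x / z - 2 / \<beta> * f' x * z)\<^sup>2 * y\<^sup>2 / 2" by simp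
    also have "\<dots> = ?P x / 2 + 2 / \<beta>\<^sup>2 * ?Q x - 2 / \<beta> * (f x * f' x * x powr (- \<beta>))"
      using alg[of "f x" "f' x"] by (simp add: y z(2)[symmetric])
    finally show "?P x / 2 - 2 / \<beta>\<^sup>2 * ?Q x \<le> ?F' x" by simp
  qed
  also have "\<dots> = ?F T - ?F l" using F by (rule integral_unique)
  \<comment> \<open>The boundary term at \<open>T\<close> has the favourable sign and the one at
    \<open>l\<close> vanishes.\<close>
  also have "\<dots> \<le> 0" using \<open>f l = 0\<close> \<beta> by simp
  finally have "integral {l..T} ?P \<le> 4 / \<beta>\<^sup>2 * integral {l..T} ?Q"
    unfolding integral_diff[OF integrable_on_divide[OF iP] integrable_on_mult_right[OF iQ]]
      integral_divide integral_mult_right by simp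
  moreover have "(\<integral>\<^sup>+x\<in>{l..T}. ennreal (?P x) \<partial>lborel) = ennreal (integral {l..T} ?P)"
    by (rule nn_integral_has_integral_lebesgue') (use iP l in auto)
  moreover have "(\<integral>\<^sup>+x\<in>{l..T}. ennreal (?Q x) \<partial>lborel) = ennreal (integral {l..T} ?Q)"
    by (rule nn_integral_has_integral_lebesgue') (use iQ l in auto)
  moreover have "0 \<le> integral {l..T} ?Q"
    by (rule integral_nonneg[OF iQ]) auto
  ultimately show ?thesis by (simp add: ennreal_leI flip: ennreal_mult)
qed

text \<open>The constant on an interval does not depend on \<open>T\<close>, so monotone convergence
  along \<open>{l<..l + n}\<close> yields the half line, even when the right-hand side is
  infinite.\<close>

lemma hardy_inequality_half_line:
  fixes f f' :: "real \<Rightarrow> real"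
  assumes deriv: "\<And>x. x \<ge> l \<Longrightarrow> (f has_real_derivative f' x) (at x)"
    and cont: "continuous_on UNIV f'" and l: "0 < l" and "f l = 0" and \<beta>: "\<beta> > 0"
    and [measurable]: "f \<in> borel_measurable borel"
  shows "(\<integral>\<^sup>+x\<in>{l<..}. ennreal ((f x)\<^sup>2 * x powr (- \<beta>) / x) \<partial>lborel)
    \<le> ennreal (4 / \<beta>\<^sup>2) * (\<integral>\<^sup>+x\<in>{l<..}. ennreal (x powr (1 - \<beta>) * (f' x)\<^sup>2) \<partial>lborel)"
proof -
  let ?P = "\<lambda>x. ennreal ((f x)\<^sup>2 * x powr (- \<beta>) / x)"
  have "(\<integral>\<^sup>+x\<in>{l<..}. ?P x \<partial>lborel) = (\<integral>\<^sup>+x. (SUP n::nat. ?P x * indicator {l<..l + n} x) \<partial>lborel)"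
  proof (rule nn_integral_cong)
    fix x :: real
    obtain n :: nat where n: "x - l \<le> n" using real_arch_simple by blast
    have "(SUP n::nat. ?P x * indicator {l<..l + n} x) = ?P x * indicator {l<..} x"
      by (rule antisym, rule SUP_least, force simp: indicator_def, rule SUP_upper2[of n])
        (use n in \<open>auto simp: indicator_def\<close>)
    then show "?P x * indicator {l<..} x = (SUP n::nat. ?P x * indicator {l<..l + n} x)" by simp
  qed
  also have "\<dots> = (SUP n::nat. \<integral>\<^sup>+x. ?P x * indicator {l<..l + n} x \<partial>lborel)"
    by (rule nn_integral_monotone_convergence_SUP)
      (auto simp: incseq_def le_fun_def intro!: mult_left_mono split: split_indicator)
  also have "\<dots> \<le> ennreal (4 / \<beta>\<^sup>2) * (\<integral>\<^sup>+x\<in>{l<..}. ennreal (x powr (1 - \<beta>) * (f' x)\<^sup>2) \<partial>lborel)"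
  proof (rule SUP_least)
    fix n :: nat
    have "(\<integral>\<^sup>+x. ?P x * indicator {l<..l + n} x \<partial>lborel) \<le> (\<integral>\<^sup>+x\<in>{l..l + n}. ?P x \<partial>lborel)"
      by (rule nn_integral_mono) (auto split: split_indicator)
    also have "\<dots> \<le> ennreal (4 / \<beta>\<^sup>2) * (\<integral>\<^sup>+x\<in>{l..l + n}. ennreal (x powr (1 - \<beta>) * (f' x)\<^sup>2) \<partial>lborel)"
      by (rule hardy_inequality_interval) (use assms in \<open>auto intro: continuous_on_subset\<close>)
    also have "\<dots> \<le> ennreal (4 / \<beta>\<^sup>2) * (\<integral>\<^sup>+x\<in>{l<..}. ennreal (x powr (1 - \<beta>) * (f' x)\<^sup>2) \<partial>lborel)"
      by (intro mult_left_mono nn_integral_mono_AE AE_I'[of "{l}"]) (auto split: split_indicator)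
    finally show "(\<integral>\<^sup>+x. ?P x * indicator {l<..l + n} x \<partial>lborel) \<le> \<dots>" .
  qed
  finally show ?thesis .
qed

section \<open>Pointwise inequalities for weights and powers\<close>

text \<open>Young's inequality in the form
  \<open>2 * v * w \<le> v\<^sup>2 / t + t * w\<^sup>2\<close>, where \<open>v\<close> and
  \<open>w\<close> carry the weights of the moment and energy densities; the prefactor restores the
  powers of \<open>t\<close> put into \<open>v\<close> and \<open>w\<close>. It splits the
  derivative of a power of \<open>U\<close> into these two densities.\<close>

lemma weighted_am_gm:
  fixes t \<beta> x y :: real
  assumes "t > 0"
  shows "\<bar>x\<bar> ^ n * \<bar>y\<bar> \<le> t powr (real (Suc n) * \<beta> / 2) / 2
    * ((\<bar>x\<bar> * t powr (- \<beta> / 2)) ^ (2 * n) / t + t powr (1 - \<beta>) * y\<^sup>2)"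
proof -
  define v where "v = (\<bar>x\<bar> * t powr (- \<beta> / 2)) ^ n"
  define w where "w = t powr (- \<beta> / 2) * \<bar>y\<bar>"
  have tt: "t powr (real (Suc n) * \<beta> / 2) * (t powr (- \<beta> / 2)) ^ n * t powr (- \<beta> / 2) = 1"
    using assms by (simp add: powr_power flip: powr_add) (simp add: field_simps)
  have "2 * v * w \<le> v\<^sup>2 / t + t * w\<^sup>2"
  proof -
    have "0 \<le> (v / sqrt t - sqrt t * w)\<^sup>2" by simp
    also have "\<dots> = v\<^sup>2 / t + t * w\<^sup>2 - 2 * v * w"
      using assms by (simp add: power2_diff power_divide power_mult_distrib)
    finally show ?thesis by simp
  qed
  moreover have "v\<^sup>2 = (\<bar>x\<bar> * t powr (- \<beta> / 2)) ^ (2 * n)"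
    by (simp add: v_def mult.commute flip: power_mult)
  moreover have "t * w\<^sup>2 = t powr (1 - \<beta>) * y\<^sup>2"
    using assms by (simp add: w_def power_mult_distrib powr_power powr_diff powr_minus field_simps)
  ultimately have "t powr (real (Suc n) * \<beta> / 2) / 2 * (2 * v * w) \<le> t powr (real (Suc n) * \<beta> / 2) / 2
    * ((\<bar>x\<bar> * t powr (- \<beta> / 2)) ^ (2 * n) / t + t powr (1 - \<beta>) * y\<^sup>2)"
    by (intro mult_left_mono) auto
  moreover have "t powr (real (Suc n) * \<beta> / 2) / 2 * (2 * v * w) = \<bar>x\<bar> ^ n * \<bar>y\<bar>
      * (t powr (real (Suc n) * \<beta> / 2) * (t powr (- \<beta> / 2)) ^ n * t powr (- \<beta> / 2))"
    by (simp add: v_def w_def power_mult_distrib)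
  ultimately show ?thesis unfolding tt by simp
qed

lemma power_le_sum_powers:
  fixes x :: real
  assumes "0 \<le> x" "j \<le> k" "k \<le> n"
  shows "x ^ k \<le> x ^ j + x ^ n"
proof (cases "x \<le> 1")
  case True
  then have "x ^ k \<le> x ^ j" using assms by (intro power_decreasing) auto
  then show ?thesis using assms by (simp add: add_increasing2)
next
  case False
  then have "x ^ k \<le> x ^ n" using assms by (intro power_increasing) auto
  then show ?thesis using assms by (simp add: add_increasing)
qed

text \<open>This pointwise interpolation reduces a real exponent to two even ones.\<close>

lemma powr_le_sum_powers:
  fixes x p :: real
  assumes "0 \<le> x" "2 \<le> p" "p \<le> n"
  shows "x powr p \<le> x\<^sup>2 + x ^ n"
proof -
  consider "x = 0" | "0 < x" "x \<le> 1" | "1 < x" using assms by linarith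
  then show ?thesis
  proof cases
    case 2
    then have "x powr p \<le> x powr 2" using assms by (intro powr_mono') auto
    then show ?thesis using 2 by (simp add: add_increasing2)
  next
    case 3
    then have "x powr p \<le> x powr n" using assms by (intro powr_mono) auto
    then show ?thesis using 3 by (simp add: powr_realpow add_increasing)
  qed (use assms in auto)
qed

subsection \<open>Functions on a half cylinder\<close>

text \<open>\<open>U\<close> plays the role of the test function in the coordinates
  \<open>(s, t)\<close>, with partial derivatives \<open>Us\<close> and \<open>Ut\<close>.
  Differentiability in \<open>s\<close> includes \<open>s = l\<close>, because integration along a
  ray starts from the zero boundary value there.\<close>

locale cylinder_function =
  fixes l \<beta> :: real and U Us Ut :: "real \<times> real \<Rightarrow> real"
  assumes l: "0 < l" and \<beta>: "0 < \<beta>"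
    and deriv_s: "\<And>s t. l \<le> s \<Longrightarrow> ((\<lambda>s. U (s, t)) has_real_derivative Us (s, t)) (at s)"
    and deriv_t: "\<And>s t. l < s \<Longrightarrow> ((\<lambda>t. U (s, t)) has_real_derivative Ut (s, t)) (at t)"
    and cont: "continuous_on UNIV U" "continuous_on UNIV Us" "continuous_on UNIV Ut"
    and boundary: "\<And>t. U (l, t) = 0"
begin

text \<open>Both are sigma-finite measures in their own right, so that Tonelli's theorem applies
  directly. The angle 0 is left out because polar coordinates are injective on the open
  strip.\<close>

abbreviation "ray \<equiv> restrict_space lborel {l<..}"
abbreviation "circ \<equiv> restrict_space lborel {0<..<2 * pi}"

text \<open>In the coordinates \<open>s = ln (a / r)\<close>, \<open>\<beta> = 1 - B\<close> and \<open>A = 1 + p / 2 * \<beta>\<close>, the two integrals of the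
  theorem are \<open>moment p\<close> and \<open>energy\<close>. The factor \<open>s powr (- \<beta> / 2)\<close> compensates the growth
  of a radial function of finite energy, so every moment is critical in the radial direction.\<close>

definition "moment_density k = (\<lambda>(s, t). (\<bar>U (s, t)\<bar> * s powr (- \<beta> / 2)) ^ k / s)"
definition "moment k = (\<integral>\<^sup>+s. \<integral>\<^sup>+t. ennreal (moment_density k (s, t)) \<partial>circ \<partial>ray)"
definition "Es = (\<lambda>(s, t). s powr (1 - \<beta>) * (Us (s, t))\<^sup>2)"
definition "Et = (\<lambda>(s, t). s powr (1 - \<beta>) * (Ut (s, t))\<^sup>2)"
definition "energy = (\<integral>\<^sup>+s. \<integral>\<^sup>+t. ennreal (Es (s, t) + Et (s, t)) \<partial>circ \<partial>ray)"

section \<open>Measurability and Tonelli's theorem on the half cylinder\<close>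

lemma borel_measurable_profile[measurable]:
  "U \<in> borel_measurable borel" "Us \<in> borel_measurable borel" "Ut \<in> borel_measurable borel"
  by (auto intro: borel_measurable_continuous_onI cont)

lemma borel_measurable_densities[measurable]:
  "moment_density k \<in> borel_measurable (borel \<Otimes>\<^sub>M borel)" "Es \<in> borel_measurable (borel \<Otimes>\<^sub>M borel)"
  "Et \<in> borel_measurable (borel \<Otimes>\<^sub>M borel)"
  unfolding moment_density_def Es_def Et_def by measurable

lemma measurable_restrict_lborel[measurable (raw)]:
  fixes S :: "real set"
  shows "f \<in> borel_measurable borel \<Longrightarrow> f \<in> borel_measurable (restrict_space lborel S)"
  by (simp add: measurable_restrict_space1)

lemma measurable_restrict_pair:
  fixes S T :: "real set"
  assumes "f \<in> borel_measurable (borel \<Otimes>\<^sub>M borel)"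
  shows "f \<in> borel_measurable (restrict_space lborel S \<Otimes>\<^sub>M restrict_space lborel T)"
proof -
  have "(\<lambda>x. x) \<in> restrict_space lborel S \<Otimes>\<^sub>M restrict_space lborel T \<rightarrow>\<^sub>M borel \<Otimes>\<^sub>M borel"
    by (subst measurable_pair_iff) (auto simp: o_def intro!: measurable_compose[OF measurable_fst] measurable_compose[OF measurable_snd] measurable_restrict_space1)
  from measurable_compose[OF this assms] show ?thesis .
qed

sublocale ray: sigma_finite_measure ray
  by (rule sigma_finite_measure_restrict_space) (auto intro: lborel.sigma_finite_measure_axioms)

sublocale circ: sigma_finite_measure circ
  by (rule sigma_finite_measure_restrict_space) (auto intro: lborel.sigma_finite_measure_axioms)

sublocale cyl: pair_sigma_finite ray circ ..

lemma nonneg: "s > l \<Longrightarrow> 0 \<le> moment_density k (s, t)" "0 \<le> Es x" "0 \<le> Et x"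
  using l by (auto simp: moment_density_def Es_def Et_def split: prod.splits)

lemma tonelli:
  assumes [measurable]: "f \<in> borel_measurable (borel \<Otimes>\<^sub>M borel)"
  shows "(\<integral>\<^sup>+t. \<integral>\<^sup>+s. ennreal (f (s, t)) \<partial>ray \<partial>circ) = (\<integral>\<^sup>+s. \<integral>\<^sup>+t. ennreal (f (s, t)) \<partial>circ \<partial>ray)"
  by (rule cyl.Fubini') (auto intro!: measurable_restrict_pair simp: split_beta')

lemma borel_measurable_circ_integral[measurable]:
  assumes [measurable]: "f \<in> borel_measurable (borel \<Otimes>\<^sub>M borel)"
  shows "(\<lambda>s. \<integral>\<^sup>+t. ennreal (f (s, t)) \<partial>circ) \<in> borel_measurable ray"
  by (rule circ.borel_measurable_nn_integral) (auto intro!: measurable_restrict_pair simp: split_beta')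

lemma borel_measurable_ray_integral[measurable]:
  assumes [measurable]: "f \<in> borel_measurable (borel \<Otimes>\<^sub>M borel)"
  shows "(\<lambda>t. \<integral>\<^sup>+s. ennreal (f (s, t)) \<partial>ray) \<in> borel_measurable circ"
  by (rule ray.borel_measurable_nn_integral) (auto intro!: measurable_restrict_pair simp: split_beta')

lemma energy_eq: "energy = (\<integral>\<^sup>+s. \<integral>\<^sup>+t. ennreal (Es (s, t)) \<partial>circ \<partial>ray) + (\<integral>\<^sup>+s. \<integral>\<^sup>+t. ennreal (Et (s, t)) \<partial>circ \<partial>ray)"
proof -
  have "energy = (\<integral>\<^sup>+s. ((\<integral>\<^sup>+t. ennreal (Es (s, t)) \<partial>circ) + (\<integral>\<^sup>+t. ennreal (Et (s, t)) \<partial>circ)) \<partial>ray)"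
    unfolding energy_def
    by (intro nn_integral_cong) (subst nn_integral_add[symmetric], auto simp: nonneg)
  also have "\<dots> = (\<integral>\<^sup>+s. \<integral>\<^sup>+t. ennreal (Es (s, t)) \<partial>circ \<partial>ray) + (\<integral>\<^sup>+s. \<integral>\<^sup>+t. ennreal (Et (s, t)) \<partial>circ \<partial>ray)"
    by (rule nn_integral_add) auto
  finally show ?thesis .
qed

text \<open>For \<open>k = 2\<close> the density is the left-hand integrand of Hardy's inequality on
  the ray with angle \<open>t\<close>, and the right-hand integrand is \<open>Es\<close>.
  Integrating over the angle and exchanging the integrals gives the bound.\<close>

lemma moment_hardy: "moment 2 \<le> ennreal (4 / \<beta>\<^sup>2) * energy"
proof -
  have "moment 2 = (\<integral>\<^sup>+t. \<integral>\<^sup>+s. ennreal (moment_density 2 (s, t)) \<partial>ray \<partial>circ)"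
    unfolding moment_def by (rule tonelli[symmetric]) measurable
  also have "\<dots> \<le> (\<integral>\<^sup>+t. ennreal (4 / \<beta>\<^sup>2) * (\<integral>\<^sup>+s. ennreal (Es (s, t)) \<partial>ray) \<partial>circ)"
  proof (rule nn_integral_mono)
    fix t
    have "(\<integral>\<^sup>+s. ennreal (moment_density 2 (s, t)) \<partial>ray)
      = (\<integral>\<^sup>+s\<in>{l<..}. ennreal ((U (s, t))\<^sup>2 * s powr (- \<beta>) / s) \<partial>lborel)"
      using l by (auto simp: nn_integral_restrict_space moment_density_def power_mult_distrib powr_power
        intro!: nn_integral_cong split: split_indicator)
    also have "\<dots> \<le> ennreal (4 / \<beta>\<^sup>2) * (\<integral>\<^sup>+s\<in>{l<..}. ennreal (s powr (1 - \<beta>) * (Us (s, t))\<^sup>2) \<partial>lborel)"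
      by (rule hardy_inequality_half_line)
        (auto intro: deriv_s l \<beta> boundary continuous_on_compose2[OF cont(2)] intro!: continuous_intros)
    also have "(\<integral>\<^sup>+s\<in>{l<..}. ennreal (s powr (1 - \<beta>) * (Us (s, t))\<^sup>2) \<partial>lborel) = (\<integral>\<^sup>+s. ennreal (Es (s, t)) \<partial>ray)"
      by (simp add: nn_integral_restrict_space Es_def)
    finally show "(\<integral>\<^sup>+s. ennreal (moment_density 2 (s, t)) \<partial>ray) \<le> ennreal (4 / \<beta>\<^sup>2) * (\<integral>\<^sup>+s. ennreal (Es (s, t)) \<partial>ray)" .
  qed
  also have "\<dots> = ennreal (4 / \<beta>\<^sup>2) * (\<integral>\<^sup>+t. \<integral>\<^sup>+s. ennreal (Es (s, t)) \<partial>ray \<partial>circ)"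
    by (rule nn_integral_cmult) auto
  also have "(\<integral>\<^sup>+t. \<integral>\<^sup>+s. ennreal (Es (s, t)) \<partial>ray \<partial>circ) = (\<integral>\<^sup>+s. \<integral>\<^sup>+t. ennreal (Es (s, t)) \<partial>circ \<partial>ray)"
    by (rule tonelli) measurable
  also have "\<dots> \<le> energy" unfolding energy_eq by simp
  finally show ?thesis by (simp add: mult_left_mono)
qed

section \<open>Pointwise bounds along rays and circles\<close>

definition "ray_majorant n t = (\<integral>\<^sup>+s. ennreal (moment_density (2 * n) (s, t) + Es (s, t)) \<partial>ray)"

text \<open>Since \<open>U\<close> vanishes at \<open>s = l\<close>, the power is at most the
  integral of the modulus of its derivative along the ray, which Young's inequality splits. The
  weight increases with \<open>s\<close> because \<beta> is positive, so its value at the upper end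
  bounds it and leaves the integral.\<close>

lemma sup_along_ray:
  assumes "s > l"
  shows "ennreal (\<bar>U (s, t)\<bar> ^ Suc n) \<le> ennreal (Suc n / 2 * s powr (real (Suc n) * \<beta> / 2)) * ray_majorant n t"
proof -
  let ?f' = "\<lambda>s. Suc n * U (s, t) ^ n * Us (s, t)"
  have "ennreal \<bar>U (s, t) ^ Suc n - U (l, t) ^ Suc n\<bar> \<le> (\<integral>\<^sup>+x\<in>{l..s}. ennreal \<bar>?f' x\<bar> \<partial>lborel)"
  proof (rule abs_diff_le_nn_integral_derivative)
    show "continuous_on {l..s} ?f'"
      by (intro continuous_intros continuous_on_compose2[OF cont(1)] continuous_on_compose2[OF cont(2)]) auto
    fix x assume "x \<in> {l..s}"
    then show "((\<lambda>s. U (s, t) ^ Suc n) has_real_derivative ?f' x) (at x)"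
      using DERIV_power[OF deriv_s[of x t], where n = "Suc n"] by (simp add: mult_ac)
  qed (use assms in auto)
  also have "\<dots> \<le> (\<integral>\<^sup>+x\<in>{l<..}. ennreal (Suc n / 2 * s powr (real (Suc n) * \<beta> / 2)) * ennreal (moment_density (2 * n) (x, t) + Es (x, t)) \<partial>lborel)"
  proof (rule nn_integral_mono_AE, rule AE_mp[OF AE_lborel_singleton[of l]], intro AE_I2 impI)
    fix x assume "x \<noteq> l"
    show "ennreal \<bar>?f' x\<bar> * indicator {l..s} x \<le> ennreal (Suc n / 2 * s powr (real (Suc n) * \<beta> / 2))
      * ennreal (moment_density (2 * n) (x, t) + Es (x, t)) * indicator {l<..} x"
    proof (cases "x \<in> {l..s}")
      case True
      then have x: "l < x" "x \<le> s" using \<open>x \<noteq> l\<close> by auto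
      have "\<bar>?f' x\<bar> = Suc n * (\<bar>U (x, t)\<bar> ^ n * \<bar>Us (x, t)\<bar>)"
        by (simp add: abs_mult power_abs)
      also have "\<dots> \<le> Suc n * (x powr (real (Suc n) * \<beta> / 2) / 2 * (moment_density (2 * n) (x, t) + Es (x, t)))"
        using weighted_am_gm[of x "U (x, t)" n "Us (x, t)" \<beta>] l x
        by (intro mult_left_mono) (auto simp: moment_density_def Es_def)
      also have "\<dots> \<le> Suc n * (s powr (real (Suc n) * \<beta> / 2) / 2 * (moment_density (2 * n) (x, t) + Es (x, t)))"
        using l x \<beta> by (intro mult_left_mono mult_right_mono divide_right_mono powr_mono2) (auto simp: nonneg)
      finally have "ennreal \<bar>?f' x\<bar> \<le> ennreal (Suc n / 2 * s powr (real (Suc n) * \<beta> / 2) * (moment_density (2 * n) (x, t) + Es (x, t)))"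
        by (intro ennreal_leI) (simp add: field_simps)
      with x show ?thesis by (subst (asm) ennreal_mult) (auto simp: nonneg)
    qed simp
  qed
  also have "\<dots> = ennreal (Suc n / 2 * s powr (real (Suc n) * \<beta> / 2)) * ray_majorant n t"
    unfolding ray_majorant_def by (subst nn_integral_cmult[symmetric]) (auto simp: nn_integral_restrict_space)
  finally show ?thesis by (simp add: boundary power_abs abs_mult)
qed

text \<open>The first summand bounds the mean over the circle of the weighted power of
  \<open>U\<close>, the second its oscillation. The factor \<open>1 / l\<close> comes from
  \<open>1 / s\<close>.\<close>

definition "circle_majorant n s = ennreal (1 / (2 * pi)) * (\<integral>\<^sup>+t. ennreal (moment_density 2 (s, t) + moment_density (2 * n) (s, t)) \<partial>circ)
  + ennreal (Suc n / (2 * l)) * (\<integral>\<^sup>+t. ennreal (moment_density (2 * n) (s, t) + Et (s, t)) \<partial>circ)"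

text \<open>On a circle there is no point where \<open>U\<close> is known to vanish. Any two values
  differ by at most the total variation \<open>?D\<close> along the arc that joins them within the
  open strip; averaging the comparison over all angles \<open>t'\<close> brings in the mean.\<close>

lemma sup_along_circle:
  assumes s: "s > l" and t: "0 < t" "t < 2 * pi"
  shows "ennreal (\<bar>U (s, t)\<bar> ^ Suc n) \<le> ennreal (1 / (2 * pi)) * (\<integral>\<^sup>+t. ennreal (\<bar>U (s, t)\<bar> ^ Suc n) \<partial>circ)
    + (\<integral>\<^sup>+t. ennreal (Suc n * (\<bar>U (s, t)\<bar> ^ n * \<bar>Ut (s, t)\<bar>)) \<partial>circ)" (is "?L \<le> _ * ?A + ?D")
proof -
  let ?f' = "\<lambda>t. Suc n * U (s, t) ^ n * Ut (s, t)"
  have 1: "ennreal \<bar>U (s, b) ^ Suc n - U (s, a) ^ Suc n\<bar> \<le> ?D" if "0 < a" "a \<le> b" "b < 2 * pi" for a b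
  proof -
    have "ennreal \<bar>U (s, b) ^ Suc n - U (s, a) ^ Suc n\<bar> \<le> (\<integral>\<^sup>+x\<in>{a..b}. ennreal \<bar>?f' x\<bar> \<partial>lborel)"
    proof (rule abs_diff_le_nn_integral_derivative)
      show "continuous_on {a..b} ?f'"
        by (intro continuous_intros continuous_on_compose2[OF cont(1)] continuous_on_compose2[OF cont(3)]) auto
      fix x assume "x \<in> {a..b}"
      then show "((\<lambda>t. U (s, t) ^ Suc n) has_real_derivative ?f' x) (at x)"
        using s DERIV_power[OF deriv_t[of s x], where n = "Suc n"] by (simp add: mult_ac)
    qed fact
    also have "\<dots> \<le> ?D"
      using that by (subst nn_integral_restrict_space)
        (auto intro!: nn_integral_mono simp: abs_mult power_abs mult.assoc split: split_indicator)
    finally show ?thesis .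
  qed
  have 2: "?L \<le> ennreal (\<bar>U (s, t')\<bar> ^ Suc n) + ?D" if t': "0 < t'" "t' < 2 * pi" for t'
  proof -
    have "?L \<le> ennreal (\<bar>U (s, t')\<bar> ^ Suc n + \<bar>U (s, t) ^ Suc n - U (s, t') ^ Suc n\<bar>)"
      using abs_triangle_ineq[of "U (s, t') ^ Suc n" "U (s, t) ^ Suc n - U (s, t') ^ Suc n"]
      by (intro ennreal_leI) (simp add: power_abs[symmetric] del: power_Suc)
    also have "\<dots> = ennreal (\<bar>U (s, t')\<bar> ^ Suc n) + ennreal \<bar>U (s, t) ^ Suc n - U (s, t') ^ Suc n\<bar>"
      by (simp add: ennreal_plus)
    also have "ennreal \<bar>U (s, t) ^ Suc n - U (s, t') ^ Suc n\<bar> \<le> ?D"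
      using 1[of t t'] 1[of t' t] t t' by (cases "t \<le> t'") (auto simp: abs_minus_commute)
    finally show ?thesis by (simp add: add_left_mono)
  qed
  have em: "emeasure circ (space circ) = ennreal (2 * pi)"
    by (simp add: emeasure_restrict_space space_restrict_space)
  \<comment> \<open>Integrate the comparison with \<open>t'\<close> over the circle, whose total
    measure is \<open>2 * pi\<close>, and then divide by this measure.\<close>
  have "ennreal (2 * pi) * ?L = (\<integral>\<^sup>+t'. ?L \<partial>circ)"
    using em by (simp add: mult.commute)
  also have "\<dots> \<le> (\<integral>\<^sup>+t'. ennreal (\<bar>U (s, t')\<bar> ^ Suc n) + ?D \<partial>circ)"
    by (intro nn_integral_mono 2) (auto simp: space_restrict_space)
  also have "\<dots> = ?A + ennreal (2 * pi) * ?D"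
    using em by (subst nn_integral_add) (auto simp: mult.commute)
  finally have "ennreal (1 / (2 * pi)) * (ennreal (2 * pi) * ?L) \<le> ennreal (1 / (2 * pi)) * (?A + ennreal (2 * pi) * ?D)"
    by (rule mult_left_mono) simp
  then show ?thesis
    by (simp add: distrib_left mult.assoc[symmetric] flip: ennreal_mult del: ennreal_mult'')
qed

text \<open>The weight turns the mean into that of a density of order \<open>n + 1\<close>. As
  \<open>2 \<le> n + 1 \<le> 2 * n\<close>, which needs \<open>1 \<le> n\<close>, the densities of
  orders 2 and \<open>2 * n\<close> dominate it. In the derivative term the weight cancels the
  prefactor of Young's inequality up to \<open>1 / s\<close>.\<close>

lemma sup_along_circle_weighted:
  assumes s: "s > l" and t: "0 < t" "t < 2 * pi" and n: "1 \<le> n"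
  shows "ennreal (s powr (- (real (Suc n) * \<beta> / 2)) / s) * ennreal (\<bar>U (s, t)\<bar> ^ Suc n) \<le> circle_majorant n s"
proof -
  let ?w = "s powr (- (real (Suc n) * \<beta> / 2)) / s"
  have "s > 0" using s l by simp
  have "ennreal ?w * ennreal (\<bar>U (s, t)\<bar> ^ Suc n) \<le>
    ennreal ?w * (ennreal (1 / (2 * pi)) * (\<integral>\<^sup>+t. ennreal (\<bar>U (s, t)\<bar> ^ Suc n) \<partial>circ)
    + (\<integral>\<^sup>+t. ennreal (Suc n * (\<bar>U (s, t)\<bar> ^ n * \<bar>Ut (s, t)\<bar>)) \<partial>circ))"
    by (intro mult_left_mono sup_along_circle assms) simp
  also have "\<dots> = ennreal (1 / (2 * pi)) * (\<integral>\<^sup>+t. ennreal ?w * ennreal (\<bar>U (s, t)\<bar> ^ Suc n) \<partial>circ)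
    + (\<integral>\<^sup>+t. ennreal ?w * ennreal (Suc n * (\<bar>U (s, t)\<bar> ^ n * \<bar>Ut (s, t)\<bar>)) \<partial>circ)"
    by (subst (1 2) nn_integral_cmult) (auto simp: distrib_left mult.left_commute)
  also have "\<dots> \<le> ennreal (1 / (2 * pi)) * (\<integral>\<^sup>+t. ennreal (moment_density 2 (s, t) + moment_density (2 * n) (s, t)) \<partial>circ)
    + (\<integral>\<^sup>+t. ennreal (Suc n / (2 * l)) * ennreal (moment_density (2 * n) (s, t) + Et (s, t)) \<partial>circ)"
  proof (intro add_mono mult_left_mono nn_integral_mono)
    fix t
    let ?v = "\<bar>U (s, t)\<bar> * s powr (- \<beta> / 2)"
    have "?w * \<bar>U (s, t)\<bar> ^ Suc n = ?v ^ Suc n / s"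
      using \<open>s > 0\<close> by (simp only: power_mult_distrib powr_power) (simp add: field_simps)
    also have "\<dots> \<le> moment_density 2 (s, t) + moment_density (2 * n) (s, t)"
      using power_le_sum_powers[of ?v 2 "Suc n" "2 * n"] n \<open>s > 0\<close>
      by (simp add: moment_density_def add_divide_distrib[symmetric] divide_right_mono del: power_Suc)
    finally show "ennreal ?w * ennreal (\<bar>U (s, t)\<bar> ^ Suc n) \<le> ennreal (moment_density 2 (s, t) + moment_density (2 * n) (s, t))"
      using \<open>s > 0\<close> by (simp add: ennreal_leI flip: ennreal_mult)
    have "?w * (Suc n * (\<bar>U (s, t)\<bar> ^ n * \<bar>Ut (s, t)\<bar>)) \<le>
      ?w * (Suc n * (s powr (real (Suc n) * \<beta> / 2) / 2 * (moment_density (2 * n) (s, t) + Et (s, t))))"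
      using weighted_am_gm[of s "U (s, t)" n "Ut (s, t)" \<beta>] \<open>s > 0\<close>
      by (intro mult_left_mono) (auto simp: moment_density_def Et_def)
    also have "\<dots> = Suc n / (2 * s) * (moment_density (2 * n) (s, t) + Et (s, t))"
      using \<open>s > 0\<close> by (simp add: powr_minus field_simps)
    also have "\<dots> \<le> Suc n / (2 * l) * (moment_density (2 * n) (s, t) + Et (s, t))"
      using s l by (intro mult_right_mono divide_left_mono) (auto simp: nonneg)
    finally show "ennreal ?w * ennreal (Suc n * (\<bar>U (s, t)\<bar> ^ n * \<bar>Ut (s, t)\<bar>))
      \<le> ennreal (Suc n / (2 * l)) * ennreal (moment_density (2 * n) (s, t) + Et (s, t))"
      using \<open>s > 0\<close> s l by (subst (1 2) ennreal_mult[symmetric]) (auto simp: nonneg intro!: ennreal_leI)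
  qed auto
  also have "\<dots> = circle_majorant n s"
    unfolding circle_majorant_def by (subst nn_integral_cmult) auto
  finally show ?thesis .
qed

lemma nn_integral_moment_density_add:
  assumes [measurable]: "f \<in> borel_measurable (borel \<Otimes>\<^sub>M borel)" and "\<And>s t. l < s \<Longrightarrow> 0 \<le> f (s, t)"
  shows "(\<integral>\<^sup>+s. \<integral>\<^sup>+t. ennreal (moment_density k (s, t) + f (s, t)) \<partial>circ \<partial>ray)
    = moment k + (\<integral>\<^sup>+s. \<integral>\<^sup>+t. ennreal (f (s, t)) \<partial>circ \<partial>ray)"
proof -
  have "(\<integral>\<^sup>+s. \<integral>\<^sup>+t. ennreal (moment_density k (s, t) + f (s, t)) \<partial>circ \<partial>ray)
    = (\<integral>\<^sup>+s. ((\<integral>\<^sup>+t. ennreal (moment_density k (s, t)) \<partial>circ) + (\<integral>\<^sup>+t. ennreal (f (s, t)) \<partial>circ)) \<partial>ray)"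
    using assms
    by (intro nn_integral_cong) (subst nn_integral_add[symmetric], auto simp: nonneg space_restrict_space ennreal_plus)
  also have "\<dots> = moment k + (\<integral>\<^sup>+s. \<integral>\<^sup>+t. ennreal (f (s, t)) \<partial>circ \<partial>ray)"
    unfolding moment_def by (rule nn_integral_add) auto
  finally show ?thesis .
qed

text \<open>Gagliardo's trick: estimate one of the two factors \<open>\<bar>U\<bar> ^ Suc n\<close> by an integral along the ray, the
  other by an integral along the circle, so that the double integral factorises. Both
  estimates only involve the moment of order \<open>2 * n\<close>.\<close>

lemma moment_step:
  assumes n: "1 \<le> n"
  shows "moment (2 * Suc n) \<le> ennreal (Suc n / 2) * (moment (2 * n) + energy)
    * (ennreal (1 / (2 * pi)) * (moment 2 + moment (2 * n)) + ennreal (Suc n / (2 * l)) * (moment (2 * n) + energy))"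
proof -
  have pt: "ennreal (moment_density (2 * Suc n) (s, t)) \<le> ennreal (Suc n / 2) * ray_majorant n t * circle_majorant n s"
    if s: "s > l" and t: "0 < t" "t < 2 * pi" for s t
  proof -
    have "s > 0" using s l by simp
    let ?u = "\<bar>U (s, t)\<bar> ^ Suc n" and ?x = "s powr (- (real (Suc n) * \<beta> / 2))"
    have x: "?x = (s powr (- \<beta> / 2)) ^ Suc n"
      using \<open>s > 0\<close> by (simp only: powr_power) (simp add: field_simps)
    \<comment> \<open>The factor \<open>1 / s\<close> goes entirely to the circle estimate, which
      requires it. The other factor cancels the growth in \<open>s\<close> of the ray estimate,
      leaving a function of \<open>t\<close> alone.\<close>
    have "moment_density (2 * Suc n) (s, t) = (?x * ?u) * (?x / s * ?u)"
      unfolding x by (simp add: moment_density_def power_mult_distrib power_mult power2_eq_square field_simps)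
    then have "ennreal (moment_density (2 * Suc n) (s, t)) = (ennreal ?x * ennreal ?u) * (ennreal (?x / s) * ennreal ?u)"
      using \<open>s > 0\<close> l by (simp only: ennreal_mult[symmetric] zero_le_mult_iff zero_le_power abs_ge_zero powr_ge_zero zero_le_divide_iff order_less_imp_le simp_thms)
    also have "\<dots> \<le> (ennreal ?x * (ennreal (Suc n / 2 * s powr (real (Suc n) * \<beta> / 2)) * ray_majorant n t)) * circle_majorant n s"
      by (intro mult_mono mult_left_mono sup_along_ray sup_along_circle_weighted assms that) auto
    also have "ennreal ?x * (ennreal (Suc n / 2 * s powr (real (Suc n) * \<beta> / 2)) * ray_majorant n t) = ennreal (Suc n / 2) * ray_majorant n t"
      proof -
        have "?x * (Suc n / 2 * s powr (real (Suc n) * \<beta> / 2)) = Suc n / 2"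
          using \<open>s > 0\<close> by (simp only: powr_minus) simp
        then show ?thesis
          by (subst mult.assoc[symmetric], subst ennreal_mult[symmetric]) (simp_all only: powr_ge_zero, simp_all)
      qed
    finally show ?thesis .
  qed
  have [measurable]: "ray_majorant n \<in> borel_measurable circ" "circle_majorant n \<in> borel_measurable ray"
    unfolding ray_majorant_def[abs_def] circle_majorant_def[abs_def] by auto
  have "moment (2 * Suc n) \<le> (\<integral>\<^sup>+s. \<integral>\<^sup>+t. ennreal (Suc n / 2) * ray_majorant n t * circle_majorant n s \<partial>circ \<partial>ray)"
    unfolding moment_def by (intro nn_integral_mono pt) (auto simp: space_restrict_space)
  \<comment> \<open>One majorant depends only on \<open>t\<close> and the other only on
    \<open>s\<close>, so the double integral becomes a product of single ones.\<close>
  also have "\<dots> = (\<integral>\<^sup>+s. ennreal (Suc n / 2) * (\<integral>\<^sup>+t. ray_majorant n t \<partial>circ) * circle_majorant n s \<partial>ray)"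
    by (intro nn_integral_cong) (simp add: nn_integral_multc nn_integral_cmult)
  also have "\<dots> = ennreal (Suc n / 2) * (\<integral>\<^sup>+t. ray_majorant n t \<partial>circ) * (\<integral>\<^sup>+s. circle_majorant n s \<partial>ray)"
    by (simp add: nn_integral_cmult)
  also have "\<dots> \<le> ennreal (Suc n / 2) * (moment (2 * n) + energy)
    * (ennreal (1 / (2 * pi)) * (moment 2 + moment (2 * n)) + ennreal (Suc n / (2 * l)) * (moment (2 * n) + energy))"
  proof (intro mult_mono mult_left_mono)
    have "(\<integral>\<^sup>+t. ray_majorant n t \<partial>circ) = (\<integral>\<^sup>+s. \<integral>\<^sup>+t. ennreal (moment_density (2 * n) (s, t) + Es (s, t)) \<partial>circ \<partial>ray)"
      unfolding ray_majorant_def by (rule tonelli[of "\<lambda>x. moment_density (2 * n) x + Es x"]) measurable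
    also have "\<dots> = moment (2 * n) + (\<integral>\<^sup>+s. \<integral>\<^sup>+t. ennreal (Es (s, t)) \<partial>circ \<partial>ray)"
      by (rule nn_integral_moment_density_add) (auto simp: nonneg)
    also have "\<dots> \<le> moment (2 * n) + energy" unfolding energy_eq by (simp add: add_left_mono)
    finally show "(\<integral>\<^sup>+t. ray_majorant n t \<partial>circ) \<le> moment (2 * n) + energy" .
    have "(\<integral>\<^sup>+s. \<integral>\<^sup>+t. ennreal (moment_density 2 (s, t) + moment_density (2 * n) (s, t)) \<partial>circ \<partial>ray) = moment 2 + moment (2 * n)"
      unfolding moment_def[of "2 * n"] by (rule nn_integral_moment_density_add) (auto simp: nonneg)
    moreover have "(\<integral>\<^sup>+s. \<integral>\<^sup>+t. ennreal (moment_density (2 * n) (s, t) + Et (s, t)) \<partial>circ \<partial>ray)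
        = moment (2 * n) + (\<integral>\<^sup>+s. \<integral>\<^sup>+t. ennreal (Et (s, t)) \<partial>circ \<partial>ray)"
      by (rule nn_integral_moment_density_add) (auto simp: nonneg)
    moreover have "\<dots> \<le> moment (2 * n) + energy" unfolding energy_eq by (simp add: add_left_mono)
    moreover have "(\<integral>\<^sup>+s. circle_majorant n s \<partial>ray)
        = ennreal (1 / (2 * pi)) * (\<integral>\<^sup>+s. \<integral>\<^sup>+t. ennreal (moment_density 2 (s, t) + moment_density (2 * n) (s, t)) \<partial>circ \<partial>ray)
        + ennreal (Suc n / (2 * l)) * (\<integral>\<^sup>+s. \<integral>\<^sup>+t. ennreal (moment_density (2 * n) (s, t) + Et (s, t)) \<partial>circ \<partial>ray)"
      unfolding circle_majorant_def by (subst nn_integral_add) (auto simp: nn_integral_cmult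
        borel_measurable_circ_integral[of "\<lambda>x. moment_density 2 x + moment_density (2 * n) x"]
        borel_measurable_circ_integral[of "\<lambda>x. moment_density (2 * n) x + Et x"])
    ultimately show "(\<integral>\<^sup>+s. circle_majorant n s \<partial>ray) \<le> ennreal (1 / (2 * pi)) * (moment 2 + moment (2 * n))
        + ennreal (Suc n / (2 * l)) * (moment (2 * n) + energy)"
      by (auto intro!: add_left_mono mult_left_mono)
  qed auto
  finally show ?thesis .
qed

end

section \<open>Uniform bounds for all exponents\<close>

text \<open>The induction starts with Hardy's inequality and continues with
  \<open>moment_step\<close>. The functions are quantified inside the existential because the
  constant has to be the same for all of them; the normalisation of the energy makes every factor of
  the step a number.\<close>

lemma even_moment_bound:
  assumes "1 \<le> n" and l: "0 < l" and \<beta>: "0 < \<beta>"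
  shows "\<exists>C\<ge>0. \<forall>U Us Ut. cylinder_function l \<beta> U Us Ut \<longrightarrow> cylinder_function.energy l \<beta> Us Ut \<le> 1
    \<longrightarrow> cylinder_function.moment l \<beta> U (2 * n) \<le> ennreal C"
  using assms(1)
proof (induction n rule: nat_induct_at_least)
  case base
  have "cylinder_function.moment l \<beta> U (2 * 1) \<le> ennreal (4 / \<beta>\<^sup>2)"
    if "cylinder_function l \<beta> U Us Ut" "cylinder_function.energy l \<beta> Us Ut \<le> 1" for U Us Ut
    using cylinder_function.moment_hardy[OF that(1)] mult_left_mono[OF that(2), of "ennreal (4 / \<beta>\<^sup>2)"] by simp
  then show ?case by (intro exI[of _ "4 / \<beta>\<^sup>2"]) auto
next
  case (Suc n)
  then obtain C where C: "C \<ge> 0" and bound: "\<And>U Us Ut. cylinder_function l \<beta> U Us Ut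
    \<Longrightarrow> cylinder_function.energy l \<beta> Us Ut \<le> 1 \<Longrightarrow> cylinder_function.moment l \<beta> U (2 * n) \<le> ennreal C" by blast
  \<comment> \<open>The bound of \<open>moment_step\<close> with 1 for the energy,
    \<open>4 / \<beta>\<^sup>2\<close> for the second moment and \<open>C\<close> for the moment of
    order \<open>2 * n\<close>.\<close>
  let ?C = "Suc n / 2 * (C + 1) * (1 / (2 * pi) * (4 / \<beta>\<^sup>2 + C) + Suc n / (2 * l) * (C + 1))"
  have "cylinder_function.moment l \<beta> U (2 * Suc n) \<le> ennreal ?C"
    if U: "cylinder_function l \<beta> U Us Ut" and energy: "cylinder_function.energy l \<beta> Us Ut \<le> 1" for U Us Ut
  proof -
    interpret cylinder_function l \<beta> U Us Ut by fact
    have J2: "moment 2 \<le> ennreal (4 / \<beta>\<^sup>2)"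
      using moment_hardy mult_left_mono[OF energy, of "ennreal (4 / \<beta>\<^sup>2)"] by simp
    have "moment (2 * n) + energy \<le> ennreal C + 1" and "moment 2 + moment (2 * n) \<le> ennreal (4 / \<beta>\<^sup>2) + ennreal C"
      by (intro add_mono bound[OF U energy] energy J2)+
    then have 1: "moment (2 * n) + energy \<le> ennreal (C + 1)" and 2: "moment 2 + moment (2 * n) \<le> ennreal (4 / \<beta>\<^sup>2 + C)"
      using C by (simp_all add: ennreal_plus)
    have "moment (2 * Suc n) \<le> ennreal (Suc n / 2) * (moment (2 * n) + energy)
      * (ennreal (1 / (2 * pi)) * (moment 2 + moment (2 * n)) + ennreal (Suc n / (2 * l)) * (moment (2 * n) + energy))"
      by (rule moment_step) (use Suc in simp)
    also have "\<dots> \<le> ennreal (Suc n / 2) * ennreal (C + 1)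
      * (ennreal (1 / (2 * pi)) * ennreal (4 / \<beta>\<^sup>2 + C) + ennreal (Suc n / (2 * l)) * ennreal (C + 1))"
      by (intro mult_mono add_mono mult_left_mono 1 2) auto
    also have "\<dots> = ennreal ?C"
      using C l by (simp add: ennreal_plus[symmetric] ennreal_mult[symmetric] del: ennreal_plus)
    finally show ?thesis .
  qed
  then show ?case using C l by (intro exI[of _ ?C]) auto
qed

lemma cylinder_function_scale:
  assumes "cylinder_function l \<beta> U Us Ut"
  shows "cylinder_function l \<beta> (\<lambda>x. c * U x) (\<lambda>x. c * Us x) (\<lambda>x. c * Ut x)"
proof -
  interpret cylinder_function l \<beta> U Us Ut by fact
  show ?thesis
    by standard (auto intro!: l \<beta> DERIV_cmult deriv_s deriv_t continuous_intros cont simp: boundary)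
qed

text \<open>Dividing \<open>U\<close> by \<open>sqrt e\<close> normalises the energy and divides the
  integral on the left by \<open>e powr (p / 2)\<close>. Then \<open>p\<close> is placed between the
  even exponents 2 and \<open>2 * n\<close>.\<close>

lemma moment_bound:
  assumes p: "2 \<le> p" and l: "0 < l" and \<beta>: "0 < \<beta>" and A: "A \<ge> 1 + p / 2 * \<beta>"
  obtains C where "0 < C" and "\<And>U Us Ut e. \<lbrakk>cylinder_function l \<beta> U Us Ut; cylinder_function.energy l \<beta> Us Ut \<le> ennreal e; 0 < e\<rbrakk>
    \<Longrightarrow> (\<integral>\<^sup>+s. \<integral>\<^sup>+t. ennreal (\<bar>U (s, t)\<bar> powr p * s powr (- A))
      \<partial>restrict_space lborel {0<..<2 * pi} \<partial>restrict_space lborel {l<..}) \<le> ennreal (C * e powr (p / 2))"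
proof -
  obtain n :: nat where n: "p \<le> n" using real_arch_simple by blast
  then have "1 \<le> n" using p by linarith
  obtain C1 where C1: "C1 \<ge> 0" and b1: "\<And>U Us Ut. cylinder_function l \<beta> U Us Ut
    \<Longrightarrow> cylinder_function.energy l \<beta> Us Ut \<le> 1 \<Longrightarrow> cylinder_function.moment l \<beta> U (2 * 1) \<le> ennreal C1"
    using even_moment_bound[of 1, OF _ l \<beta>] by blast
  obtain C2 where C2: "C2 \<ge> 0" and b2: "\<And>U Us Ut. cylinder_function l \<beta> U Us Ut
    \<Longrightarrow> cylinder_function.energy l \<beta> Us Ut \<le> 1 \<Longrightarrow> cylinder_function.moment l \<beta> U (2 * n) \<le> ennreal C2"
    using even_moment_bound[OF \<open>1 \<le> n\<close> l \<beta>] by blast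
  let ?A = "1 + p / 2 * \<beta>"
  \<comment> \<open>The exponent \<open>?A - A\<close> is at most 0, so for \<open>s > l\<close> the
    constant \<open>D\<close> bounds the factor \<open>s powr (?A - A)\<close> by which the weight
    differs from the critical one.\<close>
  define D where "D = l powr (?A - A)"
  have "D > 0" using l by (simp add: D_def)
  \<comment> \<open>The summand 1 keeps the constant strictly positive, since \<open>C1\<close> and
    \<open>C2\<close> are only known to be nonnegative.\<close>
  have "(\<integral>\<^sup>+s. \<integral>\<^sup>+t. ennreal (\<bar>U (s, t)\<bar> powr p * s powr (- A))
      \<partial>restrict_space lborel {0<..<2 * pi} \<partial>restrict_space lborel {l<..}) \<le> ennreal (D * (C1 + C2 + 1) * e powr (p / 2))"
    if U: "cylinder_function l \<beta> U Us Ut" and energy: "cylinder_function.energy l \<beta> Us Ut \<le> ennreal e" and e: "0 < e"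
    for U Us Ut e
  proof -
    interpret U: cylinder_function l \<beta> U Us Ut by fact
    define c where "c = 1 / sqrt e"
    have c: "c > 0" "c\<^sup>2 = 1 / e" "U x = sqrt e * (c * U x)" for x
      using e by (auto simp: c_def power_divide)
    have V: "cylinder_function l \<beta> (\<lambda>x. c * U x) (\<lambda>x. c * Us x) (\<lambda>x. c * Ut x)"
      using U by (rule cylinder_function_scale)
    interpret V: cylinder_function l \<beta> "\<lambda>x. c * U x" "\<lambda>x. c * Us x" "\<lambda>x. c * Ut x" by (rule V)
    have "V.energy = (\<integral>\<^sup>+s. ennreal (1 / e) * (\<integral>\<^sup>+t. ennreal (U.Es (s, t) + U.Et (s, t))
        \<partial>restrict_space lborel {0<..<2 * pi}) \<partial>restrict_space lborel {l<..})"
      unfolding V.energy_def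
    proof (intro nn_integral_cong, subst nn_integral_cmult[symmetric], simp, intro nn_integral_cong)
      fix s t
      have "V.Es (s, t) + V.Et (s, t) = 1 / e * (U.Es (s, t) + U.Et (s, t))"
        by (simp add: V.Es_def V.Et_def U.Es_def U.Et_def power_mult_distrib c(2) field_simps add_divide_distrib)
      then show "ennreal (V.Es (s, t) + V.Et (s, t)) = ennreal (1 / e) * ennreal (U.Es (s, t) + U.Et (s, t))"
        using e by (subst ennreal_mult[symmetric]) (auto simp: U.nonneg)
    qed
    also have "\<dots> = ennreal (1 / e) * U.energy"
      unfolding U.energy_def by (rule nn_integral_cmult) (rule U.borel_measurable_circ_integral[of "\<lambda>x. U.Es x + U.Et x"], simp)
    also have "\<dots> \<le> ennreal (1 / e) * ennreal e" by (intro mult_left_mono energy) simp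
    also have "\<dots> = 1" using e by (simp flip: ennreal_mult)
    finally have E1: "V.energy \<le> 1" .
    have pt: "\<bar>U (s, t)\<bar> powr p * s powr (- A) \<le> D * e powr (p / 2) * (V.moment_density 2 (s, t) + V.moment_density (2 * n) (s, t))"
      if s: "s > l" for s t
    proof -
      have "s > 0" using s l by simp
      let ?v = "\<bar>c * U (s, t)\<bar> * s powr (- \<beta> / 2)"
      have "s powr (- A) = s powr (- ?A) * s powr (?A - A)" by (simp flip: powr_add)
      also have "\<dots> \<le> s powr (- ?A) * D"
        unfolding D_def using s l A by (intro mult_left_mono powr_mono2') auto
      also have "s powr (- ?A) = s powr (- \<beta> / 2 * p) / s powr 1"
        proof -
          have "- ?A = - \<beta> / 2 * p - 1" by (simp add: field_simps)
          then show ?thesis by (simp only: powr_diff)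
        qed
      also have "\<dots> = (s powr (- \<beta> / 2)) powr p / s" using \<open>s > 0\<close> by (simp add: powr_powr)
      finally have weight: "s powr (- A) \<le> (s powr (- \<beta> / 2)) powr p / s * D" .
      have Up: "\<bar>U (s, t)\<bar> powr p = e powr (p / 2) * \<bar>c * U (s, t)\<bar> powr p"
        using e by (subst c(3)) (simp add: abs_mult powr_mult powr_half_sqrt[symmetric] powr_powr)
      have "\<bar>U (s, t)\<bar> powr p * s powr (- A) \<le> \<bar>U (s, t)\<bar> powr p * ((s powr (- \<beta> / 2)) powr p / s * D)"
        by (intro mult_left_mono weight) auto
      also have "\<dots> = D * e powr (p / 2) * (?v powr p / s)"
        unfolding Up by (subst powr_mult) auto
      also have "\<dots> \<le> D * e powr (p / 2) * ((?v\<^sup>2 + ?v ^ (2 * n)) / s)"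
        using \<open>s > 0\<close> \<open>D > 0\<close> p n by (intro mult_left_mono divide_right_mono powr_le_sum_powers) auto
      finally show ?thesis by (simp add: V.moment_density_def add_divide_distrib)
    qed
    have "(\<integral>\<^sup>+s. \<integral>\<^sup>+t. ennreal (\<bar>U (s, t)\<bar> powr p * s powr (- A))
      \<partial>restrict_space lborel {0<..<2 * pi} \<partial>restrict_space lborel {l<..})
      \<le> (\<integral>\<^sup>+s. \<integral>\<^sup>+t. ennreal (D * e powr (p / 2)) * ennreal (V.moment_density 2 (s, t) + V.moment_density (2 * n) (s, t))
      \<partial>restrict_space lborel {0<..<2 * pi} \<partial>restrict_space lborel {l<..})"
    proof (intro nn_integral_mono)
      fix s t assume "s \<in> space (restrict_space lborel {l<..})"
      then have s: "s > l" by (simp add: space_restrict_space)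
      show "ennreal (\<bar>U (s, t)\<bar> powr p * s powr (- A))
        \<le> ennreal (D * e powr (p / 2)) * ennreal (V.moment_density 2 (s, t) + V.moment_density (2 * n) (s, t))"
        using \<open>D > 0\<close> s by (subst ennreal_mult[symmetric]) (auto intro!: ennreal_leI pt simp: V.nonneg)
    qed
    also have "\<dots> = (\<integral>\<^sup>+s. ennreal (D * e powr (p / 2)) * (\<integral>\<^sup>+t. ennreal (V.moment_density 2 (s, t) + V.moment_density (2 * n) (s, t))
      \<partial>restrict_space lborel {0<..<2 * pi}) \<partial>restrict_space lborel {l<..})"
      by (intro nn_integral_cong nn_integral_cmult) simp
    also have "\<dots> = ennreal (D * e powr (p / 2)) * (\<integral>\<^sup>+s. \<integral>\<^sup>+t. ennreal (V.moment_density 2 (s, t) + V.moment_density (2 * n) (s, t))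
      \<partial>restrict_space lborel {0<..<2 * pi} \<partial>restrict_space lborel {l<..})"
      by (rule nn_integral_cmult) (rule V.borel_measurable_circ_integral[of "\<lambda>x. V.moment_density 2 x + V.moment_density (2 * n) x"], simp)
    also have "(\<integral>\<^sup>+s. \<integral>\<^sup>+t. ennreal (V.moment_density 2 (s, t) + V.moment_density (2 * n) (s, t))
      \<partial>restrict_space lborel {0<..<2 * pi} \<partial>restrict_space lborel {l<..}) = V.moment 2 + V.moment (2 * n)"
      unfolding V.moment_def[of "2 * n"] by (rule V.nn_integral_moment_density_add) (auto simp: V.nonneg)
    also have "\<dots> \<le> ennreal C1 + ennreal C2"
      using b1[OF V E1] b2[OF V E1] by (intro add_mono) auto
    also have "\<dots> \<le> ennreal (C1 + C2 + 1)" using C1 C2 by (simp add: ennreal_plus[symmetric] ennreal_leI del: ennreal_plus)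
    also have "ennreal (D * e powr (p / 2)) * ennreal (C1 + C2 + 1) = ennreal (D * (C1 + C2 + 1) * e powr (p / 2))"
      using C1 C2 \<open>D > 0\<close> by (subst ennreal_mult[symmetric]) (auto simp: ac_simps)
    finally show ?thesis by (simp add: mult_left_mono)
  qed
  moreover have "0 < D * (C1 + C2 + 1)" using C1 C2 \<open>D > 0\<close> by simp
  ultimately show thesis by (rule that[rotated])
qed

subsection \<open>Logarithmic polar coordinates\<close>

lemma measurable_vector_2 [measurable]:
  "(\<lambda>(x, y). vector [x, y] :: real^2) \<in> lborel \<Otimes>\<^sub>M lborel \<rightarrow>\<^sub>M borel"
proof -
  have vec: "(\<lambda>(x, y). vector [x, y] :: real^2) = (\<lambda>z. fst z *\<^sub>R axis 1 1 + snd z *\<^sub>R axis 2 1)"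
    by (auto simp: fun_eq_iff vec_eq_iff forall_2 axis_def)
  show ?thesis
    unfolding vec lborel_prod by (simp add: borel_measurable_continuous_onI continuous_intros)
qed

text \<open>Lebesgue measure is determined by its values on boxes, where both sides give the product
  of the side lengths. This opens the way to iterated integrals.\<close>

lemma lborel_real2: "(lborel :: (real^2) measure) = distr (lborel \<Otimes>\<^sub>M lborel) borel (\<lambda>(x, y). vector [x, y])"
proof (rule lborel_eqI)
  fix l u :: "real^2" assume le: "\<And>b. b \<in> Basis \<Longrightarrow> l \<bullet> b \<le> u \<bullet> b"
  have B: "(Basis :: (real^2) set) = {axis 1 1, axis 2 1}"
    by (auto simp: Basis_vec_def UNIV_2)
  have "emeasure (distr (lborel \<Otimes>\<^sub>M lborel) borel (\<lambda>(x, y). vector [x, y])) (box l u)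
    = emeasure (lborel \<Otimes>\<^sub>M lborel) ({l $ 1<..<u $ 1} \<times> {l $ 2<..<u $ 2})"
    by (subst emeasure_distr) (auto intro!: arg_cong[where f = "emeasure _"] simp: space_pair_measure box_def B inner_axis)
  also have "\<dots> = emeasure lborel {l $ 1<..<u $ 1} * emeasure lborel {l $ 2<..<u $ 2}"
    by (rule lborel.emeasure_pair_measure_Times) auto
  also have "\<dots> = (\<Prod>b\<in>Basis. (u - l) \<bullet> b)"
    using le[of "axis 1 1"] le[of "axis 2 1"]
    by (simp add: B inner_axis axis_eq_axis ennreal_mult)
  finally show "emeasure (distr (lborel \<Otimes>\<^sub>M lborel) borel (\<lambda>(x, y). vector [x, y])) (box l u) = (\<Prod>b\<in>Basis. (u - l) \<bullet> b)" .
qed simp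

lemma nn_integral_real2:
  fixes f :: "real^2 \<Rightarrow> ennreal"
  assumes [measurable]: "f \<in> borel_measurable borel"
  shows "(\<integral>\<^sup>+x. f x \<partial>lborel) = (\<integral>\<^sup>+s. \<integral>\<^sup>+t. f (vector [s, t]) \<partial>lborel \<partial>lborel)"
proof -
  have "(\<integral>\<^sup>+x. f x \<partial>lborel) = (\<integral>\<^sup>+z. f ((\<lambda>(x, y). vector [x, y]) z) \<partial>(lborel \<Otimes>\<^sub>M lborel))"
    by (subst lborel_real2) (rule nn_integral_distr, auto)
  also have "\<dots> = (\<integral>\<^sup>+s. \<integral>\<^sup>+t. f ((\<lambda>(x, y). vector [x, y]) (s, t)) \<partial>lborel \<partial>lborel)"
    by (rule lborel.nn_integral_fst[symmetric]) measurable
  finally show ?thesis by simp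
qed

text \<open>Logarithmic polar coordinates: radius \<open>a * exp (- s)\<close>, that is \<open>s = ln (a / r)\<close>.\<close>

definition polar :: "real \<Rightarrow> real \<times> real \<Rightarrow> real^2" where
  "polar a = (\<lambda>(s, t). (a * exp (- s) * cos t) *\<^sub>R axis 1 1 + (a * exp (- s) * sin t) *\<^sub>R axis 2 1)"

lemma polar_nth [simp]:
  "polar a (s, t) $ 1 = a * exp (- s) * cos t" "polar a (s, t) $ 2 = a * exp (- s) * sin t"
  by (simp_all add: polar_def axis_def)

lemma norm_polar:
  assumes "0 < a" shows "norm (polar a (s, t)) = a * exp (- s)"
proof -
  have "(norm (polar a (s, t)))\<^sup>2 = (a * exp (- s) * cos t)\<^sup>2 + (a * exp (- s) * sin t)\<^sup>2"
    unfolding power2_norm_eq_inner inner_vec_def UNIV_2 by (simp add: power2_eq_square)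
  also have "\<dots> = (a * exp (- s))\<^sup>2 * ((cos t)\<^sup>2 + (sin t)\<^sup>2)"
    by (simp only: power_mult_distrib distrib_left)
  finally have "(norm (polar a (s, t)))\<^sup>2 = (a * exp (- s))\<^sup>2"
    by simp
  then show ?thesis using assms by (subst (asm) power2_eq_iff_nonneg) auto
qed

lemma continuous_on_polar: "continuous_on S (polar a)"
  unfolding polar_def split_beta' by (intro continuous_intros)

text \<open>The vector-valued formula, applied with values in \<open>real^1\<close>.\<close>

lemma has_absolute_integral_change_of_variables_scalar:
  fixes f :: "real^'m::{finite,wellorder} \<Rightarrow> real" and g :: "real^'m::_ \<Rightarrow> real^'m::_"
  assumes S: "S \<in> sets lebesgue"
    and der_g: "\<And>x. x \<in> S \<Longrightarrow> (g has_derivative g' x) (at x within S)"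
    and inj: "inj_on g S"
  shows "(\<lambda>x. \<bar>det (matrix (g' x))\<bar> * f (g x)) absolutely_integrable_on S \<and>
           integral S (\<lambda>x. \<bar>det (matrix (g' x))\<bar> * f (g x)) = b
     \<longleftrightarrow> f absolutely_integrable_on (g ` S) \<and> integral (g ` S) f = b"
  using has_absolute_integral_change_of_variables[OF S der_g inj, of "\<lambda>x. vec (f x) :: real^1" "vec b"]
  by (simp add: absolutely_integrable_on_1_iff integral_on_1_eq vec_eq_iff)

text \<open>The change of variables formula concerns absolutely integrable functions. Finiteness on
  the cylinder therefore comes first; the formula carries it over to the disc together with the
  value.\<close>

lemma nn_integral_polar:
  fixes F :: "real^2 \<Rightarrow> real"
  assumes a: "0 < a" and [measurable]: "F \<in> borel_measurable borel" and F: "\<And>x. 0 \<le> F x"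
    and finite: "(\<integral>\<^sup>+s. \<integral>\<^sup>+t. ennreal ((a * exp (- s))\<^sup>2 * F (polar a (s, t)))
      \<partial>restrict_space lborel {0<..<2 * pi} \<partial>restrict_space lborel {l<..}) < \<infinity>"
  shows "(\<integral>\<^sup>+x\<in>ball 0 (a * exp (- l)). ennreal (F x) \<partial>lborel) =
    (\<integral>\<^sup>+s. \<integral>\<^sup>+t. ennreal ((a * exp (- s))\<^sup>2 * F (polar a (s, t)))
      \<partial>restrict_space lborel {0<..<2 * pi} \<partial>restrict_space lborel {l<..})" (is "_ = ?I")
proof -
  define S :: "(real^2) set" where "S = {y. l < y $ 1 \<and> 0 < y $ 2 \<and> y $ 2 < 2 * pi}"
  define g where "g = (\<lambda>y :: real^2. polar a (y $ 1, y $ 2))"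
  define g' where "g' = (\<lambda>(y :: real^2) (h :: real^2).
    (- (a * exp (- (y $ 1)) * cos (y $ 2)) * h $ 1 - a * exp (- (y $ 1)) * sin (y $ 2) * h $ 2) *\<^sub>R axis 1 1
    + (- (a * exp (- (y $ 1)) * sin (y $ 2)) * h $ 1 + a * exp (- (y $ 1)) * cos (y $ 2) * h $ 2) *\<^sub>R (axis 2 1 :: real^2))"
  define G where "G = (\<lambda>y. (a * exp (- (y $ 1)))\<^sup>2 * F (g y))"
  have [measurable]: "g \<in> borel \<rightarrow>\<^sub>M borel"
    unfolding g_def by (intro borel_measurable_continuous_onI continuous_on_compose2[OF continuous_on_polar] continuous_intros) auto
  have nth[measurable]: "(\<lambda>y :: real^2. y $ i) \<in> borel_measurable borel" for i
    by (intro borel_measurable_continuous_onI continuous_intros)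
  have S[measurable]: "S \<in> sets borel" unfolding S_def by measurable
  have G[measurable]: "G \<in> borel_measurable borel" unfolding G_def by measurable
  have G0: "0 \<le> G y" for y by (simp add: G_def F)
  have inj: "inj_on g S"
  proof (rule inj_onI)
    fix x y assume x: "x \<in> S" and y: "y \<in> S" and eq: "g x = g y"
    have 1: "x $ 1 = y $ 1"
      using arg_cong[OF eq, of norm] a by (simp add: g_def norm_polar)
    have "cos (x $ 2) = cos (y $ 2) \<and> sin (x $ 2) = sin (y $ 2)"
      using arg_cong[OF eq, of "\<lambda>z. z $ 1"] arg_cong[OF eq, of "\<lambda>z. z $ 2"] a 1 by (simp add: g_def)
    then obtain n :: int where n: "x $ 2 = y $ 2 + 2 * pi * n"
      using sin_cos_eq_iff by (metis of_int_mult of_int_numeral mult.commute mult.assoc)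
    have "\<bar>x $ 2 - y $ 2\<bar> < 2 * pi" using x y by (auto simp: S_def)
    then have "\<bar>2 * pi * n\<bar> < 2 * pi" unfolding n by simp
    then have "\<bar>real_of_int n\<bar> < 1" by (simp add: abs_mult)
    then have "n = 0" by linarith
    with n 1 show "x = y" by (simp add: vec_eq_iff forall_2)
  qed
  have der: "(g has_derivative g' y) (at y within S)" for y
    unfolding g_def polar_def g'_def prod.case
    by (rule derivative_eq_intros bounded_linear.has_derivative[OF bounded_linear_vec_nth] refl)+
      (auto simp: fun_eq_iff algebra_simps)
  \<comment> \<open>The square of the radius \<open>r\<close>, not \<open>r\<close> itself: one
    factor is the usual one, the other comes from \<open>dr = - r ds\<close>.\<close>
  have det: "\<bar>det (matrix (g' y))\<bar> = (a * exp (- (y $ 1)))\<^sup>2" for y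
  proof -
    have "det (matrix (g' y)) = - ((a * exp (- (y $ 1)) * cos (y $ 2))\<^sup>2 + (a * exp (- (y $ 1)) * sin (y $ 2))\<^sup>2)"
      unfolding det_2 matrix_def g'_def by (simp add: axis_def power2_eq_square)
    also have "\<dots> = - ((a * exp (- (y $ 1)))\<^sup>2 * ((cos (y $ 2))\<^sup>2 + (sin (y $ 2))\<^sup>2))"
      by (simp only: power_mult_distrib distrib_left)
    finally have "det (matrix (g' y)) = - ((a * exp (- (y $ 1)))\<^sup>2 * ((cos (y $ 2))\<^sup>2 + (sin (y $ 2))\<^sup>2))" .
    then show ?thesis by (simp only: sin_cos_squared_add2) simp
  qed
  have int_eq: "(\<integral>\<^sup>+x. ennreal (G x) * indicator S x \<partial>lborel) = ?I"
  proof -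
    have "(\<integral>\<^sup>+x. ennreal (G x) * indicator S x \<partial>lborel)
      = (\<integral>\<^sup>+s. \<integral>\<^sup>+t. ennreal (G (vector [s, t])) * indicator S (vector [s, t]) \<partial>lborel \<partial>lborel)"
      by (rule nn_integral_real2) measurable
    also have "\<dots> = (\<integral>\<^sup>+s. (\<integral>\<^sup>+t\<in>{0<..<2 * pi}. ennreal ((a * exp (- s))\<^sup>2 * F (polar a (s, t))) \<partial>lborel) * indicator {l<..} s \<partial>lborel)"
    proof (rule nn_integral_cong)
      fix s
      show "(\<integral>\<^sup>+t. ennreal (G (vector [s, t])) * indicator S (vector [s, t]) \<partial>lborel)
        = (\<integral>\<^sup>+t\<in>{0<..<2 * pi}. ennreal ((a * exp (- s))\<^sup>2 * F (polar a (s, t))) \<partial>lborel) * indicator {l<..} s"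
        by (cases "l < s") (auto simp: S_def G_def g_def intro!: nn_integral_cong split: split_indicator)
    qed
    finally show ?thesis by (simp add: nn_integral_restrict_space)
  qed
  have "integrable lborel (\<lambda>x. indicator S x *\<^sub>R G x)"
  proof (rule integrableI_bounded)
    have "(\<integral>\<^sup>+x. ennreal (norm (indicator S x *\<^sub>R G x)) \<partial>lborel) = (\<integral>\<^sup>+x. ennreal (G x) * indicator S x \<partial>lborel)"
      by (intro nn_integral_cong) (simp add: G0 split: split_indicator)
    then show "(\<integral>\<^sup>+x. ennreal (norm (indicator S x *\<^sub>R G x)) \<partial>lborel) < \<infinity>"
      using finite unfolding int_eq by simp
  qed simp
  then have absG: "G absolutely_integrable_on S"
    unfolding set_integrable_def by (subst integrable_completion) auto
  then have absF: "F absolutely_integrable_on (g ` S)" "integral (g ` S) F = integral S G"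
    using has_absolute_integral_change_of_variables_scalar[of S g g' F "integral S G"] der inj S
    unfolding det G_def by auto
  have "(\<integral>\<^sup>+x. ennreal (F x) * indicator (g ` S) x \<partial>lborel) = ennreal (integral (g ` S) F)"
    by (rule nn_integral_has_integral_lebesgue'[OF F integrable_integral[OF set_lebesgue_integral_eq_integral(1)[OF absF(1)]]])
  also have "\<dots> = (\<integral>\<^sup>+x. ennreal (G x) * indicator S x \<partial>lborel)"
    unfolding absF(2)
    by (rule nn_integral_has_integral_lebesgue'[OF G0 integrable_integral[OF set_lebesgue_integral_eq_integral(1)[OF absG]], symmetric])
  finally have "(\<integral>\<^sup>+x. ennreal (F x) * indicator (g ` S) x \<partial>lborel) = ?I" unfolding int_eq .
  \<comment> \<open>The image of the strip can miss points of the disc only on the horizontal axis,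
    a null set. This includes the origin, where the integrands of the theorem divide by
    zero.\<close>
  moreover have "(\<integral>\<^sup>+x\<in>ball 0 (a * exp (- l)). ennreal (F x) \<partial>lborel) = (\<integral>\<^sup>+x. ennreal (F x) * indicator (g ` S) x \<partial>lborel)"
  proof (rule nn_integral_cong_AE, rule AE_I')
    have "negligible {x :: real^2. axis 2 1 \<bullet> x = 0}" by (rule negligible_hyperplane) simp
    then have "emeasure lebesgue {x :: real^2. axis 2 1 \<bullet> x = 0} = 0"
      by (simp add: negligible_iff_null_sets null_sets_def)
    moreover have "{x :: real^2. axis 2 1 \<bullet> x = 0} \<in> sets borel"
      by (intro borel_closed closed_hyperplane)
    ultimately show "{x :: real^2. axis 2 1 \<bullet> x = 0} \<in> null_sets lborel"
      by (simp add: null_sets_def)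
    have "x \<in> g ` S" if x: "norm x < a * exp (- l)" "x $ 2 \<noteq> 0" for x
    proof -
      have "x \<noteq> 0" using x by auto
      then have nx: "0 < norm x" by simp
      have nsq: "(norm x)\<^sup>2 = (x $ 1)\<^sup>2 + (x $ 2)\<^sup>2"
        unfolding power2_norm_eq_inner inner_vec_def UNIV_2 by (simp add: power2_eq_square)
      have "(x $ 1 / norm x)\<^sup>2 + (x $ 2 / norm x)\<^sup>2 = 1"
        unfolding power_divide add_divide_distrib[symmetric] nsq[symmetric] using nx by simp
      then obtain t where t: "0 \<le> t" "t < 2 * pi" "x $ 1 / norm x = cos t" "x $ 2 / norm x = sin t"
        using sincos_total_2pi by metis
      have "t \<noteq> 0" using t(4) x nx by auto
      define s where "s = ln (a / norm x)"
      have es: "a * exp (- s) = norm x" using a nx by (simp add: s_def exp_minus)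
      have "exp (- s) < exp (- l)" using x(1) a unfolding es[symmetric] by simp
      then have "l < s" by simp
      have "g (vector [s, t]) = x"
        using t(3,4)[symmetric] nx by (simp add: g_def vec_eq_iff forall_2 es)
      moreover have "vector [s, t] \<in> S" using \<open>l < s\<close> t \<open>t \<noteq> 0\<close> by (simp add: S_def)
      ultimately show ?thesis by force
    qed
    moreover have "norm x < a * exp (- l)" if "x \<in> g ` S" for x
      using that a by (auto simp: g_def norm_polar S_def)
    ultimately have iff: "x \<in> ball 0 (a * exp (- l)) \<longleftrightarrow> x \<in> g ` S" if "x $ 2 \<noteq> 0" for x
      using that by fastforce
    show "{x \<in> space lborel. ennreal (F x) * indicator (ball 0 (a * exp (- l))) x
      \<noteq> ennreal (F x) * indicator (g ` S) x} \<subseteq> {x. axis 2 1 \<bullet> x = 0}"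
    proof (rule subsetI, rule ccontr)
      fix x assume "x \<in> {x \<in> space lborel. ennreal (F x) * indicator (ball 0 (a * exp (- l))) x
        \<noteq> ennreal (F x) * indicator (g ` S) x}" and "x \<notin> {x. axis 2 1 \<bullet> x = 0}"
      moreover from this(2) have "x $ 2 \<noteq> 0" by (simp add: inner_axis')
      ultimately show False using iff[of x] by (simp add: indicator_def)
    qed
  qed
  ultimately show ?thesis by simp
qed

subsection \<open>Test functions in the unit disc\<close>

lemma smooth_on_UNIV_D:
  assumes "smooth_on UNIV u"
  shows "u differentiable (at x)" and "continuous_on UNIV (\<lambda>x. frechet_derivative u (at x) v)"
    and "continuous_on UNIV u"
  using assms[unfolded smooth_on_def, rule_format, of "Suc 0"]
    assms[unfolded smooth_on_def, rule_format, of 0] by auto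

lemma frechet_derivative_eq_gradient:
  fixes u :: "real^2 \<Rightarrow> real"
  assumes "u differentiable (at x)"
  shows "frechet_derivative u (at x) v = gradient u x $ 1 * v $ 1 + gradient u x $ 2 * v $ 2"
proof -
  have lin: "linear (frechet_derivative u (at x))"
    using assms by (rule linear_frechet_derivative)
  have "v = v $ 1 *\<^sub>R axis 1 1 + v $ 2 *\<^sub>R axis 2 1"
    by (simp add: vec_eq_iff forall_2 axis_def)
  then have "frechet_derivative u (at x) v = frechet_derivative u (at x) (v $ 1 *\<^sub>R axis 1 1 + v $ 2 *\<^sub>R axis 2 1)"
    by simp
  also have "\<dots> = gradient u x $ 1 * v $ 1 + gradient u x $ 2 * v $ 2"
    using lin by (simp add: linear_add linear_scale gradient_def)
  finally show ?thesis .
qed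

lemma continuous_on_gradient:
  fixes u :: "real^2 \<Rightarrow> real"
  assumes "smooth_on UNIV u"
  shows "continuous_on UNIV (\<lambda>x. gradient u x $ i)"
  unfolding gradient_def vec_lambda_beta by (rule smooth_on_UNIV_D[OF assms])

lemma norm_gradient_squared:
  fixes u :: "real^2 \<Rightarrow> real"
  shows "(norm (gradient u x))\<^sup>2 = (gradient u x $ 1)\<^sup>2 + (gradient u x $ 2)\<^sup>2"
  unfolding power2_norm_eq_inner inner_vec_def UNIV_2 by (simp add: power2_eq_square)

text \<open>The radius decreases in \<open>s\<close>, so the derivative along \<open>s\<close> is
  minus the derivative of \<open>u\<close> in the direction of the position vector.\<close>

definition polar_ds :: "(real^2 \<Rightarrow> real) \<Rightarrow> real \<Rightarrow> real \<times> real \<Rightarrow> real" where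
  "polar_ds u a z = - (polar a z $ 1 * gradient u (polar a z) $ 1 + polar a z $ 2 * gradient u (polar a z) $ 2)"

text \<open>The derivative of \<open>u\<close> in the direction of the position vector turned by a
  right angle.\<close>

definition polar_dt :: "(real^2 \<Rightarrow> real) \<Rightarrow> real \<Rightarrow> real \<times> real \<Rightarrow> real" where
  "polar_dt u a z = polar a z $ 1 * gradient u (polar a z) $ 2 - polar a z $ 2 * gradient u (polar a z) $ 1"

text \<open>The position vector and its rotation are orthogonal of length \<open>r\<close>. The
  resulting factor \<open>r\<^sup>2\<close> is also the Jacobian, which expresses the conformal
  invariance of the planar Dirichlet integral.\<close>

lemma polar_ds_dt_squares:
  "(polar_ds u a (s, t))\<^sup>2 + (polar_dt u a (s, t))\<^sup>2 = (a * exp (- s))\<^sup>2 * (norm (gradient u (polar a (s, t))))\<^sup>2"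
proof -
  let ?x = "gradient u (polar a (s, t)) $ 1" and ?y = "gradient u (polar a (s, t)) $ 2" and ?r = "a * exp (- s)"
  have "(polar_ds u a (s, t))\<^sup>2 + (polar_dt u a (s, t))\<^sup>2 = ((?r * cos t)\<^sup>2 + (?r * sin t)\<^sup>2) * (?x\<^sup>2 + ?y\<^sup>2)"
    unfolding polar_ds_def polar_dt_def polar_nth by algebra
  also have "(?r * cos t)\<^sup>2 + (?r * sin t)\<^sup>2 = ?r\<^sup>2 * ((cos t)\<^sup>2 + (sin t)\<^sup>2)"
    by (simp only: power_mult_distrib distrib_left)
  finally show ?thesis by (simp add: norm_gradient_squared)
qed

lemma cylinder_function_polar:
  assumes u: "smooth_on UNIV u" and bdry: "\<And>x. norm x = 1 \<Longrightarrow> u x = 0"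
    and a: "1 < a" and \<beta>: "0 < \<beta>"
  shows "cylinder_function (ln a) \<beta> (\<lambda>z. u (polar a z)) (polar_ds u a) (polar_dt u a)"
proof
  have du: "(u has_derivative frechet_derivative u (at x)) (at x)" for x
    using smooth_on_UNIV_D(1)[OF u] by (simp add: frechet_derivative_works)
  fix s t
  have d: "((\<lambda>s. a * exp (- s) * c) has_derivative (\<lambda>h. - a * exp (- s) * c * h)) (at s)" for c
    by (rule has_field_derivative_imp_has_derivative) (auto intro!: derivative_eq_intros)
  have dc: "((\<lambda>t. a * exp (- s) * cos t) has_derivative (\<lambda>h. - a * exp (- s) * sin t * h)) (at t)"
    and ds: "((\<lambda>t. a * exp (- s) * sin t) has_derivative (\<lambda>h. a * exp (- s) * cos t * h)) (at t)"
    by (rule has_field_derivative_imp_has_derivative, auto intro!: derivative_eq_intros)+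
  have "((\<lambda>s. polar a (s, t)) has_derivative (\<lambda>h. (- a * exp (- s) * cos t * h) *\<^sub>R axis 1 1
      + (- a * exp (- s) * sin t * h) *\<^sub>R axis 2 1)) (at s)"
    unfolding polar_def prod.case
    by (intro has_derivative_add has_derivative_scaleR_left d)
  from has_derivative_compose[OF this du]
  show "((\<lambda>s. u (polar a (s, t))) has_real_derivative polar_ds u a (s, t)) (at s)"
    by (rule has_derivative_imp_has_field_derivative)
      (simp add: frechet_derivative_eq_gradient[OF smooth_on_UNIV_D(1)[OF u]] polar_ds_def axis_def algebra_simps)
  have "((\<lambda>t. polar a (s, t)) has_derivative (\<lambda>h. (- a * exp (- s) * sin t * h) *\<^sub>R axis 1 1
      + (a * exp (- s) * cos t * h) *\<^sub>R axis 2 1)) (at t)"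
    unfolding polar_def prod.case
    by (intro has_derivative_add has_derivative_scaleR_left dc ds)
  from has_derivative_compose[OF this du]
  show "((\<lambda>t. u (polar a (s, t))) has_real_derivative polar_dt u a (s, t)) (at t)"
    by (rule has_derivative_imp_has_field_derivative)
      (simp add: frechet_derivative_eq_gradient[OF smooth_on_UNIV_D(1)[OF u]] polar_dt_def axis_def algebra_simps)
  show "u (polar a (ln a, t)) = 0"
    using a by (intro bdry) (simp add: norm_polar exp_minus)
next
  show "continuous_on UNIV (\<lambda>z. u (polar a z))"
    by (intro continuous_on_compose2[OF smooth_on_UNIV_D(3)[OF u] continuous_on_polar]) auto
  have g: "continuous_on UNIV (\<lambda>z. gradient u (polar a z) $ i)" for i
    by (intro continuous_on_compose2[OF continuous_on_gradient[OF u] continuous_on_polar]) auto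
  have p: "continuous_on UNIV (\<lambda>z. polar a z $ i)" for i
    by (intro continuous_intros continuous_on_polar)
  show "continuous_on UNIV (polar_ds u a)" "continuous_on UNIV (polar_dt u a)"
    unfolding polar_ds_def[abs_def] polar_dt_def[abs_def]
    by (intro continuous_on_minus continuous_on_add continuous_on_diff continuous_on_mult p g)+
qed (use a \<beta> in auto)

lemma gradient_eq_0_outside_support:
  fixes u :: "real^2 \<Rightarrow> real"
  assumes "x \<notin> closure {x. u x \<noteq> 0}"
  shows "gradient u x = 0"
proof -
  have op: "open (- closure {x. u x \<noteq> 0})" by (simp add: open_Compl)
  have z: "u y = 0" if "y \<in> - closure {x. u x \<noteq> 0}" for y
    using that closure_subset[of "{x. u x \<noteq> 0}"] by auto
  have "((\<lambda>_. 0 :: real) has_derivative (\<lambda>_. 0)) (at x)" by simp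
  then have "(u has_derivative (\<lambda>_. 0)) (at x)"
  proof (rule has_derivative_transform_within_open[OF _ op])
    show "x \<in> - closure {x. u x \<noteq> 0}" using assms by simp
    show "0 = u y" if "y \<in> - closure {x. u x \<noteq> 0}" for y using z[OF that] by simp
  qed
  then have "frechet_derivative u (at x) = (\<lambda>_. 0)" by (rule frechet_derivative_at[symmetric])
  then show ?thesis by (simp add: gradient_def vec_eq_iff)
qed

lemma bounded_gradient_of_test_function:
  fixes u :: "real^2 \<Rightarrow> real"
  assumes u: "smooth_on UNIV u" and K: "compact (closure {x. u x \<noteq> 0})"
  shows "\<exists>M. \<forall>x. (norm (gradient u x))\<^sup>2 \<le> M"
proof -
  let ?K = "closure {x. u x \<noteq> 0}"
  have c: "continuous_on UNIV (\<lambda>x. (norm (gradient u x))\<^sup>2)"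
    unfolding norm_gradient_squared by (intro continuous_intros continuous_on_gradient[OF u])
  have "compact ((\<lambda>x. (norm (gradient u x))\<^sup>2) ` ?K)"
    by (rule compact_continuous_image[OF continuous_on_subset[OF c subset_UNIV] K])
  then have "bounded ((\<lambda>x. (norm (gradient u x))\<^sup>2) ` ?K)" by (rule compact_imp_bounded)
  then obtain M where M: "\<And>x. x \<in> ?K \<Longrightarrow> \<bar>(norm (gradient u x))\<^sup>2\<bar> \<le> M"
    unfolding bounded_iff by auto
  have "(norm (gradient u x))\<^sup>2 \<le> max M 0" for x
  proof (cases "x \<in> ?K")
    case True
    then show ?thesis using M[of x] by simp
  qed (simp add: gradient_eq_0_outside_support)
  then show ?thesis by blast
qed

text \<open>The gradient of a test function is bounded, so the factor \<open>r\<^sup>2\<close>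
  decays like \<open>exp (- 2 * s)\<close>. The power \<open>s powr (1 - \<beta>)\<close> costs at
  most a multiple of \<open>exp s\<close>, and what remains is integrable on the ray.\<close>

lemma cylinder_energy_finite:
  assumes u: "smooth_on UNIV u" and K: "compact (closure {x. u x \<noteq> 0})" and bdry: "\<And>x. norm x = 1 \<Longrightarrow> u x = 0"
    and a: "1 < a" and \<beta>: "0 < \<beta>"
  shows "cylinder_function.energy (ln a) \<beta> (polar_ds u a) (polar_dt u a) < \<infinity>"
proof -
  interpret cylinder_function "ln a" \<beta> "\<lambda>z. u (polar a z)" "polar_ds u a" "polar_dt u a"
    by (rule cylinder_function_polar[OF u bdry a \<beta>])
  obtain M where M: "\<And>x. (norm (gradient u x))\<^sup>2 \<le> M"
    using bounded_gradient_of_test_function[OF u K] by blast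
  have "M \<ge> 0" using M[of 0] by (meson order_trans zero_le_power2)
  define D where "D = ln a powr (- \<beta>) * a\<^sup>2 * M"
  have "D \<ge> 0" using \<open>M \<ge> 0\<close> by (simp add: D_def)
  have pt: "Es (s, t) + Et (s, t) \<le> D * exp (- s)" if s: "ln a < s" for s t
  proof -
    have "s > 0" using s l by simp
    have "Es (s, t) + Et (s, t) = s powr (1 - \<beta>) * ((a * exp (- s))\<^sup>2 * (norm (gradient u (polar a (s, t))))\<^sup>2)"
      by (simp add: Es_def Et_def polar_ds_dt_squares distrib_left[symmetric])
    also have "\<dots> \<le> (ln a powr (- \<beta>) * exp s) * ((a * exp (- s))\<^sup>2 * M)"
    proof (intro mult_mono mult_left_mono M)
      have se: "s \<le> exp s" using exp_ge_add_one_self[of s] by linarith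
      have "s powr (1 - \<beta>) = s powr (- \<beta>) * s"
        using \<open>s > 0\<close> by (simp add: powr_diff powr_minus field_simps)
      also have "\<dots> \<le> ln a powr (- \<beta>) * exp s"
        using s l se \<beta> \<open>s > 0\<close> by (intro mult_mono powr_mono2') auto
      finally show "s powr (1 - \<beta>) \<le> ln a powr (- \<beta>) * exp s" .
    qed (use \<open>M \<ge> 0\<close> in auto)
    also have "\<dots> = D * exp (- s)"
      by (simp add: D_def power2_eq_square exp_minus field_simps)
    finally show ?thesis .
  qed
  have "energy \<le> (\<integral>\<^sup>+s. \<integral>\<^sup>+t. ennreal (D * exp (- s)) \<partial>circ \<partial>ray)"
    unfolding energy_def by (intro nn_integral_mono ennreal_leI pt) (auto simp: space_restrict_space)
  also have "\<dots> = (\<integral>\<^sup>+s. ennreal (D * exp (- s)) * ennreal (2 * pi) \<partial>ray)"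
    by (simp add: emeasure_restrict_space space_restrict_space)
  also have "\<dots> = (\<integral>\<^sup>+s. ennreal (D * (2 * pi)) * ennreal (exp (- s)) \<partial>ray)"
    using \<open>D \<ge> 0\<close> by (intro nn_integral_cong) (simp add: ennreal_mult[symmetric] mult_ac)
  also have "\<dots> = ennreal (D * (2 * pi)) * (\<integral>\<^sup>+s. ennreal (exp (- s)) \<partial>ray)"
    by (rule nn_integral_cmult) simp
  also have "(\<integral>\<^sup>+s. ennreal (exp (- s)) \<partial>ray) \<le> (\<integral>\<^sup>+s\<in>{ln a..}. ennreal (exp (- s)) \<partial>lborel)"
    by (subst nn_integral_restrict_space) (auto intro!: nn_integral_mono split: split_indicator)
  also have "\<dots> = ennreal (0 - (- exp (- ln a)))"
  proof (rule nn_integral_FTC_atLeast)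
    show "((\<lambda>s. - exp (- s) :: real) \<longlongrightarrow> 0) at_top"
      using tendsto_minus[OF filterlim_compose[OF exp_at_bot filterlim_uminus_at_bot_at_top]] by simp
  qed (auto intro!: derivative_eq_intros)
  also have "ennreal (D * (2 * pi)) * ennreal (0 - (- exp (- ln a))) < \<infinity>"
    by (simp add: ennreal_mult_less_top)
  finally show ?thesis by (simp add: mult_left_mono)
qed

section \<open>From the disc to the domain\<close>

text \<open>Since \<open>F\<close> vanishes outside \<Omega>, its integrals over \<Omega> and over
  the larger set agree; a finite nonnegative integral then gives integrability and the value at
  once.\<close>

lemma set_integral_from_ball:
  fixes F :: "real^2 \<Rightarrow> real"
  assumes [measurable]: "F \<in> borel_measurable borel" and F: "\<And>x. 0 \<le> F x"
    and supp: "\<And>x. F x \<noteq> 0 \<Longrightarrow> x \<in> \<Omega>" and \<Omega>: "\<Omega> \<subseteq> S" "open \<Omega>"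
    and "0 \<le> r" and r: "(\<integral>\<^sup>+x\<in>S. ennreal (F x) \<partial>lborel) = ennreal r"
  shows "set_integrable lborel \<Omega> F \<and> (LINT x:\<Omega>|lborel. F x) = r"
proof -
  have eq: "ennreal (indicator \<Omega> x *\<^sub>R F x) = ennreal (F x) * indicator S x" for x
    using supp[of x] \<Omega> by (cases "F x = 0") (auto split: split_indicator)
  have [measurable]: "\<Omega> \<in> sets borel" using \<Omega> by simp
  have "has_bochner_integral lborel (\<lambda>x. indicator \<Omega> x *\<^sub>R F x) r"
  proof (rule has_bochner_integral_nn_integral)
    show "(\<integral>\<^sup>+x. ennreal (indicator \<Omega> x *\<^sub>R F x) \<partial>lborel) = ennreal r" unfolding eq by (rule r)
  qed (use F \<open>0 \<le> r\<close> in simp_all)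
  then show ?thesis
    unfolding set_integrable_def set_lebesgue_integral_def
    by (auto simp: has_bochner_integral_iff)
qed

text \<open>An open set cannot attain the supremum of the norm: a point of norm 1 could be pushed
  outwards and stay in \<Omega>.\<close>

lemma subset_unit_ball:
  fixes \<Omega> :: "'a::real_normed_vector set"
  assumes "open \<Omega>" "bounded \<Omega>" "(SUP x\<in>\<Omega>. norm x) = 1"
  shows "\<Omega> \<subseteq> ball 0 1"
proof
  fix x assume x: "x \<in> \<Omega>"
  have bdd: "bdd_above (norm ` \<Omega>)"
    using \<open>bounded \<Omega>\<close> by (auto simp: bounded_iff bdd_above_def)
  have le: "norm y \<le> 1" if "y \<in> \<Omega>" for y
    using cSUP_upper[OF that bdd] assms(3) by simp
  have "norm x \<noteq> 1"
  proof
    assume nx: "norm x = 1"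
    obtain e where e: "e > 0" "ball x e \<subseteq> \<Omega>"
      using \<open>open \<Omega>\<close> x by (meson open_contains_ball)
    have "dist x ((1 + e / 2) *\<^sub>R x) = norm ((e / 2) *\<^sub>R x)"
      by (simp add: dist_norm algebra_simps)
    then have "(1 + e / 2) *\<^sub>R x \<in> \<Omega>" using e nx by auto
    from le[OF this] show False using e nx by simp
  qed
  with le[OF x] show "x \<in> ball 0 1" by simp
qed

theorem theorem1:
  fixes \<Omega> :: "(real^2) set" and a p A B :: real
  assumes "smooth_bounded_domain \<Omega>"
    and "0 \<in> closure \<Omega>"
    and "(SUP x\<in>\<Omega>. norm x) = 1"
    and "a > 1" and "p \<ge> 2" and "B < 1" and "A \<ge> 1 + p / 2 * (1 - B)"
  shows "\<exists>C>0. \<forall>u\<in>test_functions \<Omega>.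
    set_integrable lborel \<Omega> (\<lambda>x. \<bar>u x\<bar> powr p / ((norm x)\<^sup>2 * ln (a / norm x) powr A)) \<and>
    set_integrable lborel \<Omega> (\<lambda>x. ln (a / norm x) powr B * (norm (gradient u x))\<^sup>2) \<and>
    C * (LINT x:\<Omega>|lborel. \<bar>u x\<bar> powr p / ((norm x)\<^sup>2 * ln (a / norm x) powr A)) powr (2 / p)
      \<le> (LINT x:\<Omega>|lborel. ln (a / norm x) powr B * (norm (gradient u x))\<^sup>2)"
proof -
  have \<Omega>: "open \<Omega>" "\<Omega> \<subseteq> ball 0 1"
    using assms(1,3) subset_unit_ball[of \<Omega>] by (auto simp: smooth_bounded_domain_def)
  have l: "0 < ln a" and \<beta>: "0 < 1 - B" and a: "0 < a" using assms by auto
  have exp_l: "a * exp (- ln a) = 1" using a by (simp add: exp_minus)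
  obtain C where C: "C > 0" and bound: "\<And>U Us Ut e. cylinder_function (ln a) (1 - B) U Us Ut \<Longrightarrow>
      cylinder_function.energy (ln a) (1 - B) Us Ut \<le> ennreal e \<Longrightarrow> 0 < e \<Longrightarrow>
      (\<integral>\<^sup>+s. \<integral>\<^sup>+t. ennreal (\<bar>U (s, t)\<bar> powr p * s powr (- A))
      \<partial>restrict_space lborel {0<..<2 * pi} \<partial>restrict_space lborel {ln a<..}) \<le> ennreal (C * e powr (p / 2))"
    by (rule moment_bound[OF \<open>p \<ge> 2\<close> l \<beta> assms(7)], erule that) blast
  show ?thesis
  \<comment> \<open>Raising \<open>m \<le> C * e powr (p / 2)\<close> to the power
    \<open>2 / p\<close> and solving for \<open>e\<close> produces this constant.\<close>
  proof (intro exI[of _ "C powr (- (2 / p))"] conjI ballI)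
    show "0 < C powr (- (2 / p))" using C by simp
    fix u assume "u \<in> test_functions \<Omega>"
    then have u: "smooth_on UNIV u" and K: "compact (closure {x. u x \<noteq> 0})" and supp: "closure {x. u x \<noteq> 0} \<subseteq> \<Omega>"
      by (auto simp: test_functions_def)
    have u\<Omega>: "x \<in> \<Omega>" if "u x \<noteq> 0" for x using that supp closure_subset[of "{x. u x \<noteq> 0}"] by auto
    have bdry: "u x = 0" if "norm x = 1" for x using that u\<Omega>[of x] subsetD[OF \<Omega>(2), of x] by (cases "u x = 0") auto
    let ?U = "\<lambda>z. u (polar a z)" and ?I1 = "\<lambda>x. \<bar>u x\<bar> powr p / ((norm x)\<^sup>2 * ln (a / norm x) powr A)"
      and ?I2 = "\<lambda>x. ln (a / norm x) powr B * (norm (gradient u x))\<^sup>2"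
    have cyl: "cylinder_function (ln a) (1 - B) ?U (polar_ds u a) (polar_dt u a)"
      by (rule cylinder_function_polar[OF u bdry \<open>a > 1\<close> \<beta>])
    interpret cylinder_function "ln a" "1 - B" ?U "polar_ds u a" "polar_dt u a" by (rule cyl)
    have [measurable]: "u \<in> borel_measurable borel"
      by (rule borel_measurable_continuous_onI[OF smooth_on_UNIV_D(3)[OF u]])
    have [measurable]: "(\<lambda>x. gradient u x $ i) \<in> borel_measurable borel" for i
      by (intro borel_measurable_continuous_onI continuous_on_gradient u)
    have m1: "?I1 \<in> borel_measurable borel" by measurable
    have m2: "?I2 \<in> borel_measurable borel" unfolding norm_gradient_squared by measurable
    have "energy < \<infinity>" by (rule cylinder_energy_finite[OF u K bdry \<open>a > 1\<close> \<beta>])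
    then obtain e where e: "0 \<le> e" "energy = ennreal e" by (cases energy) auto
    let ?M = "\<integral>\<^sup>+s. \<integral>\<^sup>+t. ennreal (\<bar>?U (s, t)\<bar> powr p * s powr (- A)) \<partial>circ \<partial>ray"
    have M: "?M \<le> ennreal (C * (e + \<delta>) powr (p / 2))" if "\<delta> > 0" for \<delta>
      by (rule bound[OF cyl]) (use that e in \<open>auto intro: ennreal_leI\<close>)
    have "?M < \<infinity>" using M[of 1] by (rule order.strict_trans1) auto
    then obtain m where m: "0 \<le> m" "?M = ennreal m" by (cases ?M) auto
    have lnp: "ln (a / norm (polar a (s, t))) = s" for s t
    proof -
      have "a / (a * exp (- s)) = exp s" using a by (simp add: exp_minus field_simps)
      then show ?thesis by (simp only: norm_polar[OF a] ln_exp)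
    qed
    \<comment> \<open>Here the Jacobian cancels the singular factor
      \<open>1 / (norm x)\<^sup>2\<close>; in the gradient integral below it is absorbed by the
      squares of the two derivatives.\<close>
    have "ennreal ((a * exp (- s))\<^sup>2 * ?I1 (polar a (s, t))) = ennreal (\<bar>?U (s, t)\<bar> powr p * s powr (- A))" for s t
      unfolding lnp unfolding norm_polar[OF a] using a by (simp add: powr_minus field_simps)
    then have e1: "(\<integral>\<^sup>+s. \<integral>\<^sup>+t. ennreal ((a * exp (- s))\<^sup>2 * ?I1 (polar a (s, t))) \<partial>circ \<partial>ray) = ennreal m"
      by (simp only: m(2))
    have "ennreal ((a * exp (- s))\<^sup>2 * ?I2 (polar a (s, t))) = ennreal (Es (s, t) + Et (s, t))" for s t
      unfolding lnp Es_def Et_def prod.case distrib_left[symmetric] polar_ds_dt_squares by (simp add: mult_ac)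
    then have e2: "(\<integral>\<^sup>+s. \<integral>\<^sup>+t. ennreal ((a * exp (- s))\<^sup>2 * ?I2 (polar a (s, t))) \<partial>circ \<partial>ray) = ennreal e"
      by (simp only: e(2)[symmetric] energy_def)
    have "(\<integral>\<^sup>+x\<in>ball 0 1. ennreal (?I1 x) \<partial>lborel) = ennreal m"
      using nn_integral_polar[OF a m1, of "ln a"] unfolding e1 exp_l by simp
    then have 1: "set_integrable lborel \<Omega> ?I1 \<and> (LINT x:\<Omega>|lborel. ?I1 x) = m"
      using \<open>p \<ge> 2\<close> by (intro set_integral_from_ball[OF m1 _ _ \<Omega>(2,1) m(1)]) (auto intro: u\<Omega>)
    have "(\<integral>\<^sup>+x\<in>ball 0 1. ennreal (?I2 x) \<partial>lborel) = ennreal e"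
      using nn_integral_polar[OF a m2, of "ln a"] unfolding e2 exp_l by simp
    then have 2: "set_integrable lborel \<Omega> ?I2 \<and> (LINT x:\<Omega>|lborel. ?I2 x) = e"
      using supp gradient_eq_0_outside_support[of _ u]
      by (intro set_integral_from_ball[OF m2 _ _ \<Omega>(2,1) e(1)]) auto
    \<comment> \<open>The bound is available for positive energy levels only; \<open>e\<close> may vanish.\<close>
    have "C powr (- (2 / p)) * m powr (2 / p) \<le> e"
    proof (rule field_le_epsilon)
      fix \<delta> :: real assume "\<delta> > 0"
      have "m \<le> C * (e + \<delta>) powr (p / 2)"
        using M[OF \<open>\<delta> > 0\<close>] C unfolding m(2) by simp
      then have "m powr (2 / p) \<le> (C * (e + \<delta>) powr (p / 2)) powr (2 / p)"
        using m(1) \<open>p \<ge> 2\<close> by (intro powr_mono2) auto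
      also have "\<dots> = C powr (2 / p) * (e + \<delta>)"
        using C \<open>\<delta> > 0\<close> e(1) \<open>p \<ge> 2\<close> by (simp add: powr_mult powr_powr)
      finally have "C powr (- (2 / p)) * m powr (2 / p) \<le> C powr (- (2 / p)) * (C powr (2 / p) * (e + \<delta>))"
        by (intro mult_left_mono) auto
      also have "\<dots> = e + \<delta>" using C by (simp add: powr_minus)
      finally show "C powr (- (2 / p)) * m powr (2 / p) \<le> e + \<delta>" .
    qed
    then show "set_integrable lborel \<Omega> ?I1" "set_integrable lborel \<Omega> ?I2"
      "C powr (- (2 / p)) * (LINT x:\<Omega>|lborel. ?I1 x) powr (2 / p) \<le> (LINT x:\<Omega>|lborel. ?I2 x)"
      using 1 2 by auto
  qed
qed

end
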